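(* Let $\mathfrak g$ be a $6$-dimensional real nilpotent Lie algebra endowed with a complex structure $J$ which is not bi-invariant. (a) If $J$ is non-nilpotent, then $(\mathfrak g,J)$ does not admit any LCSKT structure (i.e. there is no $J$-Hermitian metric $g$ on $\mathfrak g$ such that $(J,g)$ is LCSKT). (b) If $J$ is nilpotent, then $(\mathfrak g,J)$ admits an LCSKT structure if and only if there is a basis $\{\omega^1,\omega^2,\omega^3\}$ of $(1,0)$-forms satisfying either $$(\mathrm{I})\qquad d\omega^1=d\omega^2=0,\quad d\omega^3=\omega^{1\overline 1},$$ or $$(\mathrm{II})\qquad d\omega^1=0,\quad d\omega^2=\omega^{1\overline 1},\quad d\omega^3=\omega^{12}-\omega^{1\overline 2}.$$ Moreover, if $(\mathfrak g,J)$ has complex structure equations (I) or (II), then every Hermitian structure $(J,g)$ on it is LCSKT. In case (I), every LCSKT structure is trivial, since $dH=0$, and the $1$-form $\alpha$ is independent of the parameters $r,s,t,u,v,z$ defining the fundamental form $\Omega$ of the Hermitian structure: $$\alpha=2\,\mathrm{Re}(\lambda_1\omega^1),\qquad \lambda_1\in\mathbb C\setminus\{0\}.$$ In case (II), every LCSKT structure is non-trivial and, with $\Omega$ expressed through the parameters $r,s,t,u,v,z$, the $1$-form $\alpha$ is given by $$\alpha=\frac{2it\overline v}{ts-|v|^2}\,\omega^1-\frac{2itv}{ts-|v|^2}\,\overline\omega^1-\frac{4t^2}{ts-|v|^2}\,\mathrm{Re}(\omega^2),$$ and the nilpotent Lie algebra with complex structure equations (II) does not admit any SKT structure.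
   Context: A complex structure on a real Lie algebra $\mathfrak g$ is an endomorphism $J$ with $J^2=-\mathrm{Id}$ and $[JX,JY]-J[JX,Y]-J[X,JY]-[X,Y]=0$ for all $X,Y\in\mathfrak g$. It is bi-invariant if $J[X,Y]=[JX,Y]$ for all $X,Y$. On a $2n$-dimensional nilpotent Lie algebra, $J$ is called nilpotent if there is a basis $\{\omega^j\}_{j=1}^n$ of $(1,0)$-forms with $d\omega^1=0$ and $d\omega^j\in\Lambda^2\langle\omega^1,\dots,\omega^{j-1},\overline{\omega}^1,\dots,\overline\omega^{j-1}\rangle$ for $j=2,\dots,n$; otherwise it is non-nilpotent. Here $d$ is the Chevalley–Eilenberg differential (extended to complex forms), $\omega^{jk}=\omega^j\wedge\omega^k$ and $\omega^{j\overline k}=\omega^j\wedge\overline{\omega}^k$. A $J$-Hermitian metric is an inner product $g$ on $\mathfrak g$ with $g(JX,JY)=g(X,Y)$; $(J,g)$ is then called a Hermitian structure. Its fundamental form is $\Omega(X,Y)=g(JX,Y)$ and its Bismut torsion $3$-form is $H=d^c\Omega=i(\overline\partial-\partial)\Omega$, i.e. $H(X,Y,Z)=-d\Omega(JX,JY,JZ)$. $(J,g)$ is SKT if $dH=0$. $(J,g)$ is LCSKT if there is a non-zero closed real $1$-form $\alpha$ on $\mathfrak g$ with $dH=\alpha\wedge H$ (this is the $\alpha$ referred to in the claim). An LCSKT structure is trivial if $dH=0$ and non-trivial if $dH\neq0$. A Lie algebra admits an SKT structure if there exist a complex structure $J$ and a $J$-Hermitian metric $g$ on it with $(J,g)$ SKT.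 With respect to a basis $\{\omega^1,\omega^2,\omega^3\}$ of $(1,0)$-forms, the fundamental form of a generic Hermitian structure is $$\Omega=i(r\omega^{1\overline1}+s\omega^{2\overline2}+t\omega^{3\overline3})+u\omega^{1\overline2}-\overline u\omega^{2\overline1}+v\omega^{2\overline3}-\overline v\omega^{3\overline2}+z\omega^{1\overline3}-\overline z\omega^{3\overline1},$$ with $r,s,t\in\mathbb R$, $u,v,z\in\mathbb C$, $r,s,t>0$, $rs-|u|^2>0$, $st-|v|^2>0$, $rt-|z|^2>0$ and $rst+2\mathrm{Re}(i\overline u\,\overline v z)-t|u|^2-r|v|^2-s|z|^2>0$.
   Formalization: In case (II) the overall sign of the displayed formula for α is reversed: for r=s=t=1, u=v=z=0 one has dH=4ω^{12\bar1\bar2}≠0 and α=+4Re(ω²), so the printed formula gives dH=−α∧H instead of dH=α∧H. *)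

theory Defs
  imports "HOL-Analysis.Analysis"
begin

section \<open>Real Lie algebras\<close>

definition lie_algebra :: "('a::real_vector \<Rightarrow> 'a \<Rightarrow> 'a) \<Rightarrow> bool" where
  "lie_algebra br \<longleftrightarrow> bilinear br \<and> (\<forall>X. br X X = 0) \<and>
     (\<forall>X Y Z. br X (br Y Z) + br Y (br Z X) + br Z (br X Y) = 0)"

fun lower_central :: "('a::real_vector \<Rightarrow> 'a \<Rightarrow> 'a) \<Rightarrow> nat \<Rightarrow> 'a set" where
  "lower_central br 0 = UNIV"
| "lower_central br (Suc k) = span {br X Y | X Y. Y \<in> lower_central br k}"

definition nilpotent_lie_algebra :: "('a::real_vector \<Rightarrow> 'a \<Rightarrow> 'a) \<Rightarrow> bool" where
  "nilpotent_lie_algebra br \<longleftrightarrow> (\<exists>k. lower_central br k = {0})"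

section \<open>Forms and the Chevalley--Eilenberg differential\<close>

text \<open>A \<open>k\<close>-form is a curried function of \<open>k\<close> vectors, with values in \<open>real\<close> or, for
  complex forms, in \<open>complex\<close>.  The differential is
  \<open>d\<eta> (X\<^sub>0, \<dots>, X\<^sub>k) = (\<Sum>i<j. (-1)^(i+j) \<eta> ([X\<^sub>i, X\<^sub>j], X\<^sub>0, \<dots>, X\<^sub>k))\<close> with \<open>X\<^sub>i, X\<^sub>j\<close> omitted
  from the remaining arguments, and \<open>(\<eta> \<and> \<theta>) (X, Y) = \<eta> X \<theta> Y - \<eta> Y \<theta> X\<close>; with these
  normalisations \<open>d\<close> is a graded derivation.\<close>

definition ce_d1 :: "('a \<Rightarrow> 'a \<Rightarrow> 'a) \<Rightarrow> ('a \<Rightarrow> 'b::ab_group_add) \<Rightarrow> 'a \<Rightarrow> 'a \<Rightarrow> 'b" where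
  "ce_d1 br \<eta> X Y = - \<eta> (br X Y)"

definition ce_d2 ::
  "('a \<Rightarrow> 'a \<Rightarrow> 'a) \<Rightarrow> ('a \<Rightarrow> 'a \<Rightarrow> 'b::ab_group_add) \<Rightarrow> 'a \<Rightarrow> 'a \<Rightarrow> 'a \<Rightarrow> 'b" where
  "ce_d2 br \<eta> X Y Z = - \<eta> (br X Y) Z + \<eta> (br X Z) Y - \<eta> (br Y Z) X"

definition ce_d3 ::
  "('a \<Rightarrow> 'a \<Rightarrow> 'a) \<Rightarrow> ('a \<Rightarrow> 'a \<Rightarrow> 'a \<Rightarrow> 'b::ab_group_add) \<Rightarrow> 'a \<Rightarrow> 'a \<Rightarrow> 'a \<Rightarrow> 'a \<Rightarrow> 'b" where
  "ce_d3 br \<eta> X Y Z W =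
     - \<eta> (br X Y) Z W + \<eta> (br X Z) Y W - \<eta> (br X W) Y Z
     - \<eta> (br Y Z) X W + \<eta> (br Y W) X Z - \<eta> (br Z W) X Y"

definition wedge11 :: "('a \<Rightarrow> 'b::comm_ring) \<Rightarrow> ('a \<Rightarrow> 'b) \<Rightarrow> 'a \<Rightarrow> 'a \<Rightarrow> 'b" where
  "wedge11 \<eta> \<theta> X Y = \<eta> X * \<theta> Y - \<eta> Y * \<theta> X"

definition wedge13 ::
  "('a \<Rightarrow> 'b::comm_ring) \<Rightarrow> ('a \<Rightarrow> 'a \<Rightarrow> 'a \<Rightarrow> 'b) \<Rightarrow> 'a \<Rightarrow> 'a \<Rightarrow> 'a \<Rightarrow> 'a \<Rightarrow> 'b" where
  "wedge13 \<eta> \<theta> X Y Z W =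
     \<eta> X * \<theta> Y Z W - \<eta> Y * \<theta> X Z W + \<eta> Z * \<theta> X Y W - \<eta> W * \<theta> X Y Z"

definition conj_form :: "('a \<Rightarrow> complex) \<Rightarrow> 'a \<Rightarrow> complex" where
  "conj_form \<eta> X = cnj (\<eta> X)"

section \<open>Complex structures\<close>

definition complex_structure ::
  "('a::real_vector \<Rightarrow> 'a \<Rightarrow> 'a) \<Rightarrow> ('a \<Rightarrow> 'a) \<Rightarrow> bool" where
  "complex_structure br J \<longleftrightarrow> linear J \<and> (\<forall>X. J (J X) = - X) \<and>
     (\<forall>X Y. br (J X) (J Y) - J (br (J X) Y) - J (br X (J Y)) - br X Y = 0)"

definition bi_invariant :: "('a \<Rightarrow> 'a \<Rightarrow> 'a) \<Rightarrow> ('a \<Rightarrow> 'a) \<Rightarrow> bool" where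
  "bi_invariant br J \<longleftrightarrow> (\<forall>X Y. J (br X Y) = br (J X) Y)"

definition form_10 :: "('a::real_vector \<Rightarrow> 'a) \<Rightarrow> ('a \<Rightarrow> complex) \<Rightarrow> bool" where
  "form_10 J \<eta> \<longleftrightarrow> linear \<eta> \<and> (\<forall>X. \<eta> (J X) = \<i> * \<eta> X)"

text \<open>The family \<open>\<omega> 1, \<dots>, \<omega> n\<close> is a basis of the complex vector space of \<open>(1,0)\<close>-forms; values
  of \<open>\<omega>\<close> at other indices are irrelevant.\<close>

definition basis_10 :: "('a::real_vector \<Rightarrow> 'a) \<Rightarrow> nat \<Rightarrow> (nat \<Rightarrow> 'a \<Rightarrow> complex) \<Rightarrow> bool" where
  "basis_10 J n \<omega> \<longleftrightarrow>
     (\<forall>j\<in>{1..n}. form_10 J (\<omega> j)) \<and>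
     (\<forall>c. (\<forall>X. (\<Sum>j=1..n. c j * \<omega> j X) = 0) \<longrightarrow> (\<forall>j\<in>{1..n}. c j = 0)) \<and>
     (\<forall>\<eta>. form_10 J \<eta> \<longrightarrow> (\<exists>c. \<forall>X. \<eta> X = (\<Sum>j=1..n. c j * \<omega> j X)))"

text \<open>Membership of a 2-form in the second exterior power of the complex span of
  \<open>\<omega> 1, \<dots>, \<omega> m\<close> and their conjugates.\<close>

definition in_ext2 :: "(nat \<Rightarrow> 'a \<Rightarrow> complex) \<Rightarrow> nat \<Rightarrow> ('a \<Rightarrow> 'a \<Rightarrow> complex) \<Rightarrow> bool" where
  "in_ext2 \<omega> m \<theta> \<longleftrightarrow> (\<exists>a b c. \<forall>X Y. \<theta> X Y =
     (\<Sum>k=1..m. \<Sum>l=1..m.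
        a k l * wedge11 (\<omega> k) (\<omega> l) X Y
      + b k l * wedge11 (\<omega> k) (conj_form (\<omega> l)) X Y
      + c k l * wedge11 (conj_form (\<omega> k)) (conj_form (\<omega> l)) X Y))"

definition nilpotent_complex_structure ::
  "('a::real_vector \<Rightarrow> 'a \<Rightarrow> 'a) \<Rightarrow> ('a \<Rightarrow> 'a) \<Rightarrow> bool" where
  "nilpotent_complex_structure br J \<longleftrightarrow>
     (\<exists>n \<omega>. dim (UNIV :: 'a set) = 2 * n \<and> basis_10 J n \<omega> \<and>
        ce_d1 br (\<omega> 1) = (\<lambda>_ _. 0) \<and>
        (\<forall>j\<in>{2..n}. in_ext2 \<omega> (j - 1) (ce_d1 br (\<omega> j))))"

section \<open>Hermitian, SKT and LCSKT structures\<close>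

definition hermitian_metric ::
  "('a::real_vector \<Rightarrow> 'a) \<Rightarrow> ('a \<Rightarrow> 'a \<Rightarrow> real) \<Rightarrow> bool" where
  "hermitian_metric J g \<longleftrightarrow> bilinear g \<and> (\<forall>X Y. g X Y = g Y X) \<and>
     (\<forall>X. X \<noteq> 0 \<longrightarrow> g X X > 0) \<and> (\<forall>X Y. g (J X) (J Y) = g X Y)"

definition fundamental_form ::
  "('a \<Rightarrow> 'a) \<Rightarrow> ('a \<Rightarrow> 'a \<Rightarrow> real) \<Rightarrow> 'a \<Rightarrow> 'a \<Rightarrow> real" where
  "fundamental_form J g X Y = g (J X) Y"

definition bismut_torsion ::
  "('a \<Rightarrow> 'a \<Rightarrow> 'a) \<Rightarrow> ('a \<Rightarrow> 'a) \<Rightarrow> ('a \<Rightarrow> 'a \<Rightarrow> real) \<Rightarrow> 'a \<Rightarrow> 'a \<Rightarrow> 'a \<Rightarrow> real" where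
  "bismut_torsion br J g X Y Z = - ce_d2 br (fundamental_form J g) (J X) (J Y) (J Z)"

definition SKT ::
  "('a::real_vector \<Rightarrow> 'a \<Rightarrow> 'a) \<Rightarrow> ('a \<Rightarrow> 'a) \<Rightarrow> ('a \<Rightarrow> 'a \<Rightarrow> real) \<Rightarrow> bool" where
  "SKT br J g \<longleftrightarrow> hermitian_metric J g \<and>
     ce_d3 br (bismut_torsion br J g) = (\<lambda>_ _ _ _. 0)"

definition LCSKT_form ::
  "('a::real_vector \<Rightarrow> 'a \<Rightarrow> 'a) \<Rightarrow> ('a \<Rightarrow> 'a) \<Rightarrow> ('a \<Rightarrow> 'a \<Rightarrow> real) \<Rightarrow> ('a \<Rightarrow> real) \<Rightarrow> bool" where
  "LCSKT_form br J g \<alpha> \<longleftrightarrow> linear \<alpha> \<and> \<alpha> \<noteq> (\<lambda>_. 0) \<and> ce_d1 br \<alpha> = (\<lambda>_ _. 0) \<and>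
     ce_d3 br (bismut_torsion br J g) = wedge13 \<alpha> (bismut_torsion br J g)"

definition LCSKT ::
  "('a::real_vector \<Rightarrow> 'a \<Rightarrow> 'a) \<Rightarrow> ('a \<Rightarrow> 'a) \<Rightarrow> ('a \<Rightarrow> 'a \<Rightarrow> real) \<Rightarrow> bool" where
  "LCSKT br J g \<longleftrightarrow> hermitian_metric J g \<and> (\<exists>\<alpha>. LCSKT_form br J g \<alpha>)"

definition trivial_LCSKT ::
  "('a::real_vector \<Rightarrow> 'a \<Rightarrow> 'a) \<Rightarrow> ('a \<Rightarrow> 'a) \<Rightarrow> ('a \<Rightarrow> 'a \<Rightarrow> real) \<Rightarrow> bool" where
  "trivial_LCSKT br J g \<longleftrightarrow> LCSKT br J g \<and>
     ce_d3 br (bismut_torsion br J g) = (\<lambda>_ _ _ _. 0)"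

definition nontrivial_LCSKT ::
  "('a::real_vector \<Rightarrow> 'a \<Rightarrow> 'a) \<Rightarrow> ('a \<Rightarrow> 'a) \<Rightarrow> ('a \<Rightarrow> 'a \<Rightarrow> real) \<Rightarrow> bool" where
  "nontrivial_LCSKT br J g \<longleftrightarrow> LCSKT br J g \<and>
     ce_d3 br (bismut_torsion br J g) \<noteq> (\<lambda>_ _ _ _. 0)"

definition admits_LCSKT ::
  "('a::real_vector \<Rightarrow> 'a \<Rightarrow> 'a) \<Rightarrow> ('a \<Rightarrow> 'a) \<Rightarrow> bool" where
  "admits_LCSKT br J \<longleftrightarrow> (\<exists>g. LCSKT br J g)"

definition admits_SKT :: "('a::real_vector \<Rightarrow> 'a \<Rightarrow> 'a) \<Rightarrow> bool" where
  "admits_SKT br \<longleftrightarrow> (\<exists>J g. complex_structure br J \<and> SKT br J g)"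

text \<open>The 2-form \<open>\<Omega>\<close> has parameters \<open>r, s, t, u, v, z\<close> with respect to \<open>\<omega> 1, \<omega> 2, \<omega> 3\<close>; the
  inequalities are the positivity of the principal minors of the matrix of the metric.\<close>

definition form_parameters ::
  "(nat \<Rightarrow> 'a \<Rightarrow> complex) \<Rightarrow> ('a \<Rightarrow> 'a \<Rightarrow> real) \<Rightarrow>
   real \<Rightarrow> real \<Rightarrow> real \<Rightarrow> complex \<Rightarrow> complex \<Rightarrow> complex \<Rightarrow> bool" where
  "form_parameters \<omega> \<Omega> r s t u v z \<longleftrightarrow>
     r > 0 \<and> s > 0 \<and> t > 0 \<and>
     r * s - (cmod u)\<^sup>2 > 0 \<and> s * t - (cmod v)\<^sup>2 > 0 \<and> r * t - (cmod z)\<^sup>2 > 0 \<and>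
     r * s * t + 2 * Re (\<i> * cnj u * cnj v * z)
       - t * (cmod u)\<^sup>2 - r * (cmod v)\<^sup>2 - s * (cmod z)\<^sup>2 > 0 \<and>
     (\<forall>X Y. let W = (\<lambda>j k. wedge11 (\<omega> j) (conj_form (\<omega> k)) X Y) in
        complex_of_real (\<Omega> X Y) =
          \<i> * (complex_of_real r * W 1 1 + complex_of_real s * W 2 2 + complex_of_real t * W 3 3)
          + u * W 1 2 - cnj u * W 2 1 + v * W 2 3 - cnj v * W 3 2 + z * W 1 3 - cnj z * W 3 1)"

section \<open>The two families of complex structure equations\<close>

definition equations_I ::
  "('a \<Rightarrow> 'a \<Rightarrow> 'a) \<Rightarrow> (nat \<Rightarrow> 'a \<Rightarrow> complex) \<Rightarrow> bool" where
  "equations_I br \<omega> \<longleftrightarrow>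
     ce_d1 br (\<omega> 1) = (\<lambda>_ _. 0) \<and> ce_d1 br (\<omega> 2) = (\<lambda>_ _. 0) \<and>
     ce_d1 br (\<omega> 3) = wedge11 (\<omega> 1) (conj_form (\<omega> 1))"

definition equations_II ::
  "('a \<Rightarrow> 'a \<Rightarrow> 'a) \<Rightarrow> (nat \<Rightarrow> 'a \<Rightarrow> complex) \<Rightarrow> bool" where
  "equations_II br \<omega> \<longleftrightarrow>
     ce_d1 br (\<omega> 1) = (\<lambda>_ _. 0) \<and>
     ce_d1 br (\<omega> 2) = wedge11 (\<omega> 1) (conj_form (\<omega> 1)) \<and>
     ce_d1 br (\<omega> 3) =
       (\<lambda>X Y. wedge11 (\<omega> 1) (\<omega> 2) X Y - wedge11 (\<omega> 1) (conj_form (\<omega> 2)) X Y)"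

end

theory Submission
  imports Defs
begin

text \<open>
  Everything is done with real vectors.  For a Hermitian structure on a Lie algebra the torsion is
  \<open>H(X, Y, Z) = g([JX, JY], Z) + g([JY, JZ], X) + g([JZ, JX], Y)\<close>, so \<open>dH = \<alpha> \<and> H\<close> can be tested on
  well chosen quadruples of vectors.  The whole argument turns on whether the centre contains a
  complex line \<open>\<langle>X, JX\<rangle>\<close>.  By lemmas \<open>nilpotent_if_adapted_frame\<close> and \<open>central_line_if_nilpotent\<close>
  this happens exactly when \<open>J\<close> is nilpotent.

  If there is no such line, choose \<open>X \<noteq> 0\<close> central and in the derived algebra.  Integrability makes
  \<open>ad JX\<close> complex linear, and nilpotency forces it to have complex rank one; this pins down nearly all
  brackets (\<open>no_central_line_structure\<close>).  Evaluating \<open>dH = \<alpha> \<and> H\<close> on three quadruples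
  makes \<open>\<alpha>\<close> vanish on \<open>X, JX, Y, JY\<close>, where \<open>JX\<close> and \<open>Y\<close> do not commute, and then the quadruple
  \<open>(X, JX, Y, JY)\<close> says that \<open>[JX, Y] = 0\<close>.  This proves (a).

  If there is such a line \<open>V\<close>, there is a \<open>J\<close>-invariant subspace \<open>P\<close> of real dimension four, the kernel of a
  closed \<open>(1,0)\<close>-form, with \<open>V \<subseteq> P\<close>, \<open>[\<gg>, \<gg>] \<subseteq> P\<close> and \<open>[P, \<gg>] \<subseteq> V\<close>.  For \<open>Y \<notin> P\<close> and \<open>p \<in> P\<close> the number
  \<open>dH(Y, JY, p, Jp)\<close> is a sum of four squares of norms of brackets (when \<open>p\<close> and \<open>Jp\<close> commute), while
  the quadruples containing a vector of \<open>V\<close> control \<open>\<alpha>\<close>.  Either \<open>P\<close> can be chosen central, which is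
  family (I), or the algebra has family (II) (\<open>equations_I_or_II_if_closing_form\<close>).  The same sum
  of squares shows that an SKT structure forces \<open>[\<gg>, [\<gg>, \<gg>]] = 0\<close> for any complex structure, so the
  three-step algebra (II) has none.

  Conversely, in family (I) one has \<open>H = \<beta> \<and> g(q, \<cdot>)\<close> with \<open>\<beta>\<close> a decomposable 2-form, hence \<open>dH = 0\<close>, and for
  closed \<open>\<alpha>\<close> the equation \<open>\<alpha> \<and> H = 0\<close> means that \<open>\<alpha>\<close> is a combination of the factors of \<open>\<beta>\<close>.  In family (II) the equation
  reduces to a linear system for \<open>\<alpha>\<close> whose determinant is a positive multiple of a Gram determinant.
\<close>

text \<open>The forms of a basis are indexed by \<open>1, 2, 3\<close>; the rewriting of \<open>1\<close> to \<open>Suc 0\<close> would hide this.\<close>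

declare One_nat_def [simp del]

section \<open>Complex linear algebra on a real vector space\<close>

locale almost_complex =
  fixes J :: "'a::real_vector \<Rightarrow> 'a"
  assumes linear_J: "linear J" and JJ [simp]: "J (J X) = - X"
begin

lemma J_simps [simp]:
  "J (X + Y) = J X + J Y" "J (X - Y) = J X - J Y" "J (- X) = - J X" "J 0 = 0"
  "J (c *\<^sub>R X) = c *\<^sub>R J X"
  by (rule linear_add[OF linear_J] linear_diff[OF linear_J] linear_neg[OF linear_J]
      linear_0[OF linear_J] linear_scale[OF linear_J])+

definition cmul :: "complex \<Rightarrow> 'a \<Rightarrow> 'a" where
  "cmul z X = Re z *\<^sub>R X + Im z *\<^sub>R J X"

lemma cmul_cmul: "cmul z (cmul w X) = cmul (z * w) X"
  by (simp add: cmul_def algebra_simps)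

lemma cmul_simps [simp]: "cmul 0 X = 0" "cmul 1 X = X" "cmul z 0 = 0" "J (cmul z X) = cmul z (J X)"
  by (simp_all add: cmul_def)

lemma cmul_i [simp]: "cmul \<i> X = J X"
  by (simp add: cmul_def)

lemma cmul_inverse: "z \<noteq> 0 \<Longrightarrow> cmul (inverse z) (cmul z X) = X"
  "z \<noteq> 0 \<Longrightarrow> cmul (\<i> * inverse z) (cmul z X) = J X"
  by (simp_all add: cmul_cmul mult.assoc)

lemma J_span:
  assumes "\<And>x. x \<in> B \<Longrightarrow> J x \<in> span B" "x \<in> span B"
  shows "J x \<in> span B"
  using assms(2)
  by (induction rule: span_induct_alt)
     (simp_all add: assms(1) span_add span_scale span_zero)

text \<open>A real linear relation \<open>y = k Jy + u\<close> with \<open>u \<in> U\<close> gives \<open>(1 + k\<^sup>2) y \<in> U\<close> after applying \<open>J\<close>: real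
  independence modulo a \<open>J\<close>-invariant subspace is automatically complex independence.\<close>

lemma J_notin_span_insert:
  assumes "subspace U" "\<And>x. x \<in> U \<Longrightarrow> J x \<in> U" "y \<notin> U"
  shows "y \<notin> span (insert (J y) U)"
proof
  assume "y \<in> span (insert (J y) U)"
  then obtain k where k: "y - k *\<^sub>R J y \<in> U"
    using span_breakdown_eq[of y "J y" U] assms(1) by (auto simp: span_eq_iff[THEN iffD2])
  have "(y - k *\<^sub>R J y) + k *\<^sub>R J (y - k *\<^sub>R J y) = (1 + k * k) *\<^sub>R y"
    by (simp add: algebra_simps)
  moreover have "(y - k *\<^sub>R J y) + k *\<^sub>R J (y - k *\<^sub>R J y) \<in> U"
    using k assms by (metis subspace_add subspace_scale)
  ultimately have "(1 + k * k) *\<^sub>R y \<in> U" by simp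
  then have "inverse (1 + k * k) *\<^sub>R (1 + k * k) *\<^sub>R y \<in> U"
    using assms(1) by (metis subspace_scale)
  moreover have "1 + k * k \<noteq> 0"
    by (smt (verit) zero_le_square)
  ultimately show False using assms(3) by simp
qed

lemma real_functional_exists:
  fixes y :: 'a
  assumes "subspace U" "y \<notin> U"
  obtains f :: "'a \<Rightarrow> real" where "linear f" "\<And>x. x \<in> U \<Longrightarrow> f x = 0" "f y = 1"
proof -
  obtain B where B: "B \<subseteq> U" "independent B" "U \<subseteq> span B"
    using basis_exists[of U] by metis
  have sB: "span B = U"
    using B assms(1) by (metis span_minimal subset_antisym)
  then have "independent (insert y B)" using B assms(2)
    by (simp add: independent_insert)
  then obtain f :: "'a \<Rightarrow> real" where f: "linear f" "\<forall>x\<in>insert y B. f x = (if x = y then 1 else 0)"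
    using linear_independent_extend[of "insert y B" "\<lambda>x. if x = y then 1 else 0"] by auto
  have "f x = 0" if "x \<in> U" for x
  proof -
    have "x \<in> span B" using that sB by simp
    then show ?thesis
    proof (induction rule: span_induct_alt)
      case base then show ?case using f(1) by (simp add: linear_0)
    next
      case (step c x y')
      then have "f x = 0" using f(2) B(1) assms(2) by auto
      then show ?case using step f(1) by (simp add: linear_add linear_scale)
    qed
  qed
  with f that show ?thesis by auto
qed

text \<open>Complexify a real functional \<open>f\<close> that vanishes on \<open>U\<close> and at \<open>J y\<close>: the form \<open>f - \<i> f \<circ> J\<close> is of type
  \<open>(1,0)\<close>.\<close>

lemma form_10_exists:
  assumes "subspace U" "\<And>x. x \<in> U \<Longrightarrow> J x \<in> U" "y \<notin> U"
  obtains \<eta> where "form_10 J \<eta>" "\<And>x. x \<in> U \<Longrightarrow> \<eta> x = 0" "\<eta> y = 1"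
proof -
  obtain f :: "'a \<Rightarrow> real" where f: "linear f" "\<And>x. x \<in> span (insert (J y) U) \<Longrightarrow> f x = 0" "f y = 1"
    using real_functional_exists[of "span (insert (J y) U)" y] J_notin_span_insert[OF assms] by auto
  define \<eta> where "\<eta> x = complex_of_real (f x) - \<i> * complex_of_real (f (J x))" for x
  have "form_10 J \<eta>"
    unfolding form_10_def
    by (auto intro!: linearI simp: \<eta>_def linear_add[OF f(1)] linear_scale[OF f(1)] linear_neg[OF f(1)]
        algebra_simps scaleR_conv_of_real)
  moreover have "\<eta> x = 0" if "x \<in> U" for x
    using that f(2)[of x] f(2)[of "J x"] assms(2)[of x] by (simp add: \<eta>_def span_base)
  moreover have "\<eta> y = 1" using f by (simp add: \<eta>_def span_base)
  ultimately show ?thesis using that by blast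
qed

lemma form_10_simps:
  assumes "form_10 J \<eta>"
  shows "\<eta> (X + Y) = \<eta> X + \<eta> Y" "\<eta> (X - Y) = \<eta> X - \<eta> Y" "\<eta> (- X) = - \<eta> X" "\<eta> 0 = 0"
    "\<eta> (c *\<^sub>R X) = of_real c * \<eta> X" "\<eta> (J X) = \<i> * \<eta> X" "\<eta> (cmul z X) = z * \<eta> X"
proof -
  have l: "linear \<eta>" and J: "\<And>X. \<eta> (J X) = \<i> * \<eta> X" using assms by (auto simp: form_10_def)
  show "\<eta> (X + Y) = \<eta> X + \<eta> Y" "\<eta> (X - Y) = \<eta> X - \<eta> Y" "\<eta> (- X) = - \<eta> X" "\<eta> 0 = 0"
     "\<eta> (c *\<^sub>R X) = of_real c * \<eta> X" "\<eta> (J X) = \<i> * \<eta> X"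
    using l J by (simp_all add: linear_add linear_diff linear_neg linear_0 linear_scale scaleR_conv_of_real)
  have "\<eta> (cmul z X) = (of_real (Re z) + \<i> * of_real (Im z)) * \<eta> X"
    using l J by (simp add: cmul_def linear_add linear_scale scaleR_conv_of_real algebra_simps)
  then show "\<eta> (cmul z X) = z * \<eta> X" by (simp add: complex_eq[symmetric])
qed

text \<open>Real bases of complex subspaces, built up by adding the pairs \<open>y, J y\<close>.\<close>

definition complex_independent :: "'a set \<Rightarrow> bool" where
  "complex_independent B \<longleftrightarrow> finite B \<and> independent B \<and> (\<forall>x\<in>span B. J x \<in> span B)"

lemma complex_independent_insert:
  assumes "complex_independent B" "y \<notin> span B"
  shows "complex_independent (insert y (insert (J y) B))"
    "card (insert y (insert (J y) B)) = card B + 2"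
proof -
  have B: "finite B" "independent B" "\<And>x. x \<in> span B \<Longrightarrow> J x \<in> span B"
    using assms(1) by (auto simp: complex_independent_def)
  have 1: "J y \<notin> span B" using assms(2) B(3)[of "J y"] span_neg[of "-y" B] by auto
  have 2: "y \<notin> span (insert (J y) B)"
  proof
    assume "y \<in> span (insert (J y) B)"
    then have "y \<in> span (insert (J y) (span B))"
      by (meson insert_mono span_mono span_superset subsetD)
    then show False using J_notin_span_insert[of "span B" y] B(3) assms(2) by auto
  qed
  have i: "independent (insert y (insert (J y) B))"
    using 1 2 B(2) by (auto simp: independent_insert span_base)
  have "J x \<in> span (insert y (insert (J y) B))" if "x \<in> span (insert y (insert (J y) B))" for x
  proof (rule J_span[OF _ that])
    fix x assume "x \<in> insert y (insert (J y) B)"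
    then show "J x \<in> span (insert y (insert (J y) B))"
      using B(3)[of x] span_mono[OF subset_insertI2[OF subset_insertI], of B y "J y"]
      by (auto simp: span_base span_neg)
  qed
  then show "complex_independent (insert y (insert (J y) B))" using i B by (auto simp: complex_independent_def)
  show "card (insert y (insert (J y) B)) = card B + 2"
    using 1 2 B(1) by (metis Suc_1 add_Suc_right card_insert_disjoint finite_insert
        plus_1_eq_Suc span_base add.commute)
qed

text \<open>A basis of the complex vector space \<open>('a, J)\<close> together with its dual basis of \<open>(1,0)\<close>-forms.\<close>

definition dual_frame ::
  "('a \<Rightarrow> complex) \<Rightarrow> ('a \<Rightarrow> complex) \<Rightarrow> ('a \<Rightarrow> complex) \<Rightarrow> 'a \<Rightarrow> 'a \<Rightarrow> 'a \<Rightarrow> bool" where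
  "dual_frame w1 w2 w3 e1 e2 e3 \<longleftrightarrow>
     form_10 J w1 \<and> form_10 J w2 \<and> form_10 J w3 \<and>
     w1 e1 = 1 \<and> w1 e2 = 0 \<and> w1 e3 = 0 \<and>
     w2 e1 = 0 \<and> w2 e2 = 1 \<and> w2 e3 = 0 \<and>
     w3 e1 = 0 \<and> w3 e2 = 0 \<and> w3 e3 = 1 \<and>
     (\<forall>X. X = cmul (w1 X) e1 + cmul (w2 X) e2 + cmul (w3 X) e3)"

lemma dual_frame_simps:
  assumes "dual_frame w1 w2 w3 e1 e2 e3"
  shows "form_10 J w1" "form_10 J w2" "form_10 J w3" "w1 e1 = 1" "w1 e2 = 0" "w1 e3 = 0"
     "w2 e1 = 0" "w2 e2 = 1" "w2 e3 = 0" "w3 e1 = 0" "w3 e2 = 0" "w3 e3 = 1"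
  using assms by (auto simp: dual_frame_def)

lemma dual_frame_expand:
  "dual_frame w1 w2 w3 e1 e2 e3 \<Longrightarrow> X = cmul (w1 X) e1 + cmul (w2 X) e2 + cmul (w3 X) e3"
  by (auto simp: dual_frame_def)

lemma dual_frame_eqI:
  assumes "dual_frame w1 w2 w3 e1 e2 e3" "w1 X = w1 Y" "w2 X = w2 Y" "w3 X = w3 Y"
  shows "X = Y"
  using dual_frame_expand[OF assms(1), of X] dual_frame_expand[OF assms(1), of Y] assms by simp

lemma dual_frame_basis_10:
  assumes f: "dual_frame (\<omega> 1) (\<omega> 2) (\<omega> 3) e1 e2 e3"
  shows "basis_10 J 3 \<omega>"
proof -
  note s = dual_frame_simps[OF f]
  have I: "{1..3} = {1, 2, 3::nat}" by auto
  have sum: "(\<Sum>j=1..3. h j) = h 1 + h 2 + h 3" for h :: "nat \<Rightarrow> complex"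
    unfolding I by (simp add: add.assoc)
  have "c 1 = 0 \<and> c 2 = 0 \<and> c 3 = 0" if "\<forall>X. c 1 * \<omega> 1 X + c 2 * \<omega> 2 X + c 3 * \<omega> 3 X = 0" for c :: "nat \<Rightarrow> complex"
    using that[rule_format, of e1] that[rule_format, of e2] that[rule_format, of e3] s by simp
  moreover have "\<exists>c::nat \<Rightarrow> complex. \<forall>X. \<eta> X = c 1 * \<omega> 1 X + c 2 * \<omega> 2 X + c 3 * \<omega> 3 X" if "form_10 J \<eta>" for \<eta>
  proof -
    define c where "c j = (if j = 1 then \<eta> e1 else if j = 2 then \<eta> e2 else \<eta> e3)" for j :: nat
    have "\<eta> X = c 1 * \<omega> 1 X + c 2 * \<omega> 2 X + c 3 * \<omega> 3 X" for X
    proof -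
      have "\<eta> X = \<eta> (cmul (\<omega> 1 X) e1 + cmul (\<omega> 2 X) e2 + cmul (\<omega> 3 X) e3)"
        using dual_frame_expand[OF f, of X] by simp
      then show ?thesis by (simp add: form_10_simps[OF that] c_def)
    qed
    then show ?thesis by blast
  qed
  ultimately show ?thesis unfolding basis_10_def sum unfolding I using s by (simp del: One_nat_def)
qed

lemma dual_frame_span:
  assumes "dual_frame w1 w2 w3 e1 e2 e3"
  shows "span {e1, J e1, e2, J e2, e3, J e3} = UNIV"
proof -
  have "cmul z e \<in> span {e1, J e1, e2, J e2, e3, J e3}" if "e \<in> {e1, e2, e3}" for z e
    using that unfolding cmul_def by (intro span_add span_scale span_base) auto
  then have "X \<in> span {e1, J e1, e2, J e2, e3, J e3}" for X
    by (subst dual_frame_expand[OF assms, of X]) (simp add: span_add)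
  then show ?thesis by auto
qed

end

locale almost_complex_6 = almost_complex J for J :: "'a::real_vector \<Rightarrow> 'a" +
  assumes dim_6: "dim (UNIV :: 'a set) = 6"
begin

lemma complex_independent_card:
  assumes "complex_independent B"
  shows "card B = 6 \<Longrightarrow> span B = UNIV" and "card B < 6 \<Longrightarrow> span B \<noteq> UNIV"
proof -
  obtain T where "T \<subseteq> (UNIV :: 'a set)" and T: "independent T" "UNIV \<subseteq> span T" "card T = dim (UNIV :: 'a set)"
    by (rule basis_exists)
  have fT: "finite T" using T(3) dim_6 card.infinite by fastforce
  have le: "card B' \<le> 6" if "complex_independent B'" for B'
    using independent_span_bound[OF fT, of B'] that T dim_6 by (auto simp: complex_independent_def)
  show "span B = UNIV" if "card B = 6"
  proof (rule ccontr)
    assume "span B \<noteq> UNIV"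
    then obtain y where "y \<notin> span B" by auto
    from complex_independent_insert[OF assms this] le that show False by fastforce
  qed
  show "span B \<noteq> UNIV" if "card B < 6"
    using that dim_le_card[of UNIV B] assms dim_6 by (auto simp: complex_independent_def)
qed

text \<open>Forms that are dual up to a triangular matrix exist by lemma \<open>form_10_exists\<close>; one step of
  Gaussian elimination makes them dual.\<close>

lemma dual_frame_exists:
  assumes "e3 \<noteq> 0" "e2 \<notin> span {e3, J e3}" "e1 \<notin> span {e2, J e2, e3, J e3}"
  obtains w1 w2 w3 where "dual_frame w1 w2 w3 e1 e2 e3"
proof -
  have c0: "complex_independent {}" by (simp add: complex_independent_def independent_empty)
  have c1: "complex_independent {e3, J e3}" "card {e3, J e3} = 2"
    using complex_independent_insert[OF c0, of e3] assms(1) by auto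
  have c2: "complex_independent {e2, J e2, e3, J e3}" "card {e2, J e2, e3, J e3} = 4"
    using complex_independent_insert[OF c1(1) assms(2)] c1(2) by auto
  have c3: "complex_independent {e1, J e1, e2, J e2, e3, J e3}" "card {e1, J e1, e2, J e2, e3, J e3} = 6"
    using complex_independent_insert[OF c2(1) assms(3)] c2(2) by auto
  obtain w1 where w1: "form_10 J w1" "\<And>x. x \<in> span {e2, J e2, e3, J e3} \<Longrightarrow> w1 x = 0" "w1 e1 = 1"
    using form_10_exists[of "span {e2, J e2, e3, J e3}" e1] c2 assms(3)
    by (auto simp: complex_independent_def)
  obtain v2 where v2: "form_10 J v2" "\<And>x. x \<in> span {e3, J e3} \<Longrightarrow> v2 x = 0" "v2 e2 = 1"
    using form_10_exists[of "span {e3, J e3}" e2] c1 assms(2)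
    by (auto simp: complex_independent_def)
  obtain v3 where v3: "form_10 J v3" "v3 e3 = 1"
    using form_10_exists[of "span {}" e3] assms(1) by auto
  define w2 where "w2 X = v2 X - v2 e1 * w1 X" for X
  define w3 where "w3 X = v3 X - v3 e2 * w2 X - v3 e1 * w1 X" for X
  have f2: "form_10 J w2" using w1(1) v2(1) unfolding form_10_def w2_def
    by (auto intro!: linearI simp: linear_add linear_scale algebra_simps scaleR_conv_of_real)
  have f3: "form_10 J w3" using w1(1) f2 v3(1) unfolding form_10_def w3_def
    by (auto intro!: linearI simp: linear_add linear_scale algebra_simps scaleR_conv_of_real)
  have v: "w1 e2 = 0" "w1 e3 = 0" "v2 e3 = 0" using w1(2) v2(2) by (auto simp: span_base)
  have d: "w2 e1 = 0" "w2 e2 = 1" "w2 e3 = 0" "w3 e1 = 0" "w3 e2 = 0" "w3 e3 = 1"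
    by (simp_all add: w2_def w3_def v w1 v2 v3)
  have "X = cmul (w1 X) e1 + cmul (w2 X) e2 + cmul (w3 X) e3" for X
  proof -
    have "X \<in> span {e1, J e1, e2, J e2, e3, J e3}" using complex_independent_card(1)[OF c3] by auto
    then show ?thesis
    proof (induction rule: span_induct_alt)
      case base then show ?case by (simp add: form_10_simps[OF w1(1)] form_10_simps[OF f2] form_10_simps[OF f3])
    next
      case (step c x y)
      have "x = cmul (w1 x) e1 + cmul (w2 x) e2 + cmul (w3 x) e3"
        using step(1) d v w1(3)
        by (auto simp: form_10_simps[OF w1(1)] form_10_simps[OF f2] form_10_simps[OF f3] cmul_def)
      then have "c *\<^sub>R x + y = c *\<^sub>R (cmul (w1 x) e1 + cmul (w2 x) e2 + cmul (w3 x) e3)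
          + (cmul (w1 y) e1 + cmul (w2 y) e2 + cmul (w3 y) e3)"
        using step(2) by simp
      also have "\<dots> = cmul (w1 (c *\<^sub>R x + y)) e1 + cmul (w2 (c *\<^sub>R x + y)) e2 + cmul (w3 (c *\<^sub>R x + y)) e3"
        by (simp add: form_10_simps[OF w1(1)] form_10_simps[OF f2] form_10_simps[OF f3] cmul_def algebra_simps)
      finally show ?case .
    qed
  qed
  then have "dual_frame w1 w2 w3 e1 e2 e3"
    unfolding dual_frame_def using w1 f2 f3 d v by blast
  then show ?thesis by (rule that)
qed

lemma some_dual_frame_exists:
  obtains w1 w2 w3 e1 e2 e3 where "dual_frame w1 w2 w3 e1 e2 e3"
proof -
  have c0: "complex_independent {}" by (simp add: complex_independent_def independent_empty)
  obtain e3 :: 'a where e3: "e3 \<noteq> 0" using complex_independent_card(2)[OF c0] by auto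
  have c1: "complex_independent {e3, J e3}" "card {e3, J e3} = 2"
    using complex_independent_insert[OF c0, of e3] e3 by auto
  obtain e2 where e2: "e2 \<notin> span {e3, J e3}" using complex_independent_card(2)[OF c1(1)] c1(2) by auto
  have c2: "complex_independent {e2, J e2, e3, J e3}" "card {e2, J e2, e3, J e3} = 4"
    using complex_independent_insert[OF c1(1) e2] c1(2) by auto
  obtain e1 where "e1 \<notin> span {e2, J e2, e3, J e3}" using complex_independent_card(2)[OF c2(1)] c2(2) by auto
  with e3 e2 show ?thesis using dual_frame_exists that by metis
qed

text \<open>A given \<open>(1,0)\<close>-form can be kept as the first form of the frame, provided that the last two vectors
  lie in its kernel.\<close>

lemma dual_frame_with_first:
  assumes \<eta>: "form_10 J \<eta>" "\<eta> e1 = 1" "\<eta> e2 = 0" "\<eta> e3 = 0" and e: "e3 \<noteq> 0" "e2 \<notin> span {e3, J e3}"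
  obtains w2 w3 where "dual_frame \<eta> w2 w3 e1 e2 e3"
proof -
  note s = form_10_simps[OF \<eta>(1)]
  have "\<eta> u = 0" if "u \<in> span {e2, J e2, e3, J e3}" for u
    using that by (induction rule: span_induct_alt) (auto simp: s \<eta>)
  then have "e1 \<notin> span {e2, J e2, e3, J e3}" using \<eta>(2) by force
  then obtain w1 w2 w3 where f: "dual_frame w1 w2 w3 e1 e2 e3" using dual_frame_exists[OF e] by blast
  have "\<eta> U = \<eta> (cmul (w1 U) e1 + cmul (w2 U) e2 + cmul (w3 U) e3)" for U
    using dual_frame_expand[OF f, of U] by simp
  then have "\<eta> = w1" by (auto simp: s \<eta>)
  then show ?thesis using f that by blast
qed

lemma dual_frame_with_first_last:
  assumes \<eta>: "form_10 J \<eta>" "\<eta> e1 = 1" "\<eta> e3 = 0" and e: "e3 \<noteq> 0"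
  obtains e2 w2 w3 where "dual_frame \<eta> w2 w3 e1 e2 e3"
proof -
  note s = form_10_simps[OF \<eta>(1)]
  have c1: "complex_independent {e3, J e3}" "card {e3, J e3} = 2"
    using complex_independent_insert[of "{}" e3] e by (auto simp: complex_independent_def independent_empty)
  have "\<eta> u = 0" if "u \<in> span {e3, J e3}" for u
    using that by (induction rule: span_induct_alt) (auto simp: s \<eta>)
  then have "e1 \<notin> span {e3, J e3}" using \<eta>(2) by force
  then have "complex_independent {e1, J e1, e3, J e3}" "card {e1, J e1, e3, J e3} = 4"
    using complex_independent_insert[OF c1(1)] c1(2) by auto
  then obtain q where q: "q \<notin> span {e1, J e1, e3, J e3}" using complex_independent_card(2) by fastforce
  define e2 where "e2 = q - cmul (\<eta> q) e1"
  have "e2 \<notin> span {e3, J e3}"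
  proof
    assume "e2 \<in> span {e3, J e3}"
    then have "e2 \<in> span {e1, J e1, e3, J e3}" using span_mono[of "{e3, J e3}" "{e1, J e1, e3, J e3}"] by auto
    moreover have "cmul (\<eta> q) e1 \<in> span {e1, J e1, e3, J e3}"
      unfolding cmul_def by (intro span_add span_scale span_base) auto
    ultimately have "e2 + cmul (\<eta> q) e1 \<in> span {e1, J e1, e3, J e3}" by (rule span_add)
    then show False using q by (simp add: e2_def)
  qed
  moreover have "\<eta> e2 = 0" by (simp add: e2_def s \<eta>)
  ultimately show ?thesis using dual_frame_with_first[OF \<eta>(1,2) _ \<eta>(3) e] that by metis
qed

text \<open>The transition matrix between the given basis and the forms of an arbitrary frame has a left
  inverse because the basis generates, and linear independence of the basis makes this a right
  inverse; its coefficients define the vectors of the new frame.\<close>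

lemma basis_10_dual_frame:
  assumes "basis_10 J 3 \<omega>"
  obtains e1 e2 e3 where "dual_frame (\<omega> 1) (\<omega> 2) (\<omega> 3) e1 e2 e3"
proof -
  have I: "{1..3} = {1, 2, 3::nat}" by auto
  have sum: "(\<Sum>j=1..3. h j) = h 1 + h 2 + h 3" for h :: "nat \<Rightarrow> complex"
    unfolding I by (simp add: add.assoc)
  have \<omega>: "form_10 J (\<omega> 1)" "form_10 J (\<omega> 2)" "form_10 J (\<omega> 3)"
    using assms by (auto simp: basis_10_def)
  have ind: "c 1 = 0 \<and> c 2 = 0 \<and> c 3 = 0" if "\<And>X. c 1 * \<omega> 1 X + c 2 * \<omega> 2 X + c 3 * \<omega> 3 X = 0" for c :: "nat \<Rightarrow> complex"
    using assms that unfolding basis_10_def sum unfolding I by (simp del: One_nat_def)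
  have gen: "\<exists>c1 c2 c3. \<forall>X. \<eta> X = c1 * \<omega> 1 X + c2 * \<omega> 2 X + c3 * \<omega> 3 X" if "form_10 J \<eta>" for \<eta>
    using assms that unfolding basis_10_def sum by metis
  obtain w1 w2 w3 f1 f2 f3 where f: "dual_frame w1 w2 w3 f1 f2 f3" by (rule some_dual_frame_exists)
  note s = dual_frame_simps[OF f]
  obtain a1 a2 a3 where a: "\<And>X. w1 X = a1 * \<omega> 1 X + a2 * \<omega> 2 X + a3 * \<omega> 3 X" using gen[OF s(1)] by blast
  obtain b1 b2 b3 where b: "\<And>X. w2 X = b1 * \<omega> 1 X + b2 * \<omega> 2 X + b3 * \<omega> 3 X" using gen[OF s(2)] by blast
  obtain c1 c2 c3 where c: "\<And>X. w3 X = c1 * \<omega> 1 X + c2 * \<omega> 2 X + c3 * \<omega> 3 X" using gen[OF s(3)] by blast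
  define e1 where "e1 = cmul a1 f1 + cmul b1 f2 + cmul c1 f3"
  define e2 where "e2 = cmul a2 f1 + cmul b2 f2 + cmul c2 f3"
  define e3 where "e3 = cmul a3 f1 + cmul b3 f2 + cmul c3 f3"
  have *: "\<eta> e1 = l1 \<and> \<eta> e2 = l2 \<and> \<eta> e3 = l3"
    if \<eta>: "form_10 J \<eta>" and l: "\<And>X. \<eta> X = l1 * \<omega> 1 X + l2 * \<omega> 2 X + l3 * \<omega> 3 X" for \<eta> l1 l2 l3
  proof -
    define d where "d j = (if j = 1 then \<eta> e1 - l1 else if j = 2 then \<eta> e2 - l2 else \<eta> e3 - l3)" for j :: nat
    have "d 1 * \<omega> 1 X + d 2 * \<omega> 2 X + d 3 * \<omega> 3 X = 0" for X
    proof -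
      have "\<eta> X = \<eta> (cmul (w1 X) f1 + cmul (w2 X) f2 + cmul (w3 X) f3)"
        using dual_frame_expand[OF f, of X] by simp
      also have "\<dots> = w1 X * \<eta> f1 + w2 X * \<eta> f2 + w3 X * \<eta> f3" by (simp add: form_10_simps[OF \<eta>])
      also have "\<dots> = \<eta> e1 * \<omega> 1 X + \<eta> e2 * \<omega> 2 X + \<eta> e3 * \<omega> 3 X"
        unfolding a b c by (simp add: e1_def e2_def e3_def form_10_simps[OF \<eta>] algebra_simps)
      finally show ?thesis using l[of X] by (simp add: d_def algebra_simps)
    qed
    from ind[OF this] show ?thesis by (simp add: d_def)
  qed
  have d: "\<omega> 1 e1 = 1" "\<omega> 1 e2 = 0" "\<omega> 1 e3 = 0" "\<omega> 2 e1 = 0" "\<omega> 2 e2 = 1" "\<omega> 2 e3 = 0"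
     "\<omega> 3 e1 = 0" "\<omega> 3 e2 = 0" "\<omega> 3 e3 = 1"
    using *[OF \<omega>(1), of 1 0 0] *[OF \<omega>(2), of 0 1 0] *[OF \<omega>(3), of 0 0 1] by auto
  have "X = cmul (\<omega> 1 X) e1 + cmul (\<omega> 2 X) e2 + cmul (\<omega> 3 X) e3" for X
  proof (rule dual_frame_eqI[OF f])
    show "w1 X = w1 (cmul (\<omega> 1 X) e1 + cmul (\<omega> 2 X) e2 + cmul (\<omega> 3 X) e3)"
      unfolding a by (simp add: form_10_simps[OF \<omega>(1)] form_10_simps[OF \<omega>(2)] form_10_simps[OF \<omega>(3)] d)
    show "w2 X = w2 (cmul (\<omega> 1 X) e1 + cmul (\<omega> 2 X) e2 + cmul (\<omega> 3 X) e3)"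
      unfolding b by (simp add: form_10_simps[OF \<omega>(1)] form_10_simps[OF \<omega>(2)] form_10_simps[OF \<omega>(3)] d)
    show "w3 X = w3 (cmul (\<omega> 1 X) e1 + cmul (\<omega> 2 X) e2 + cmul (\<omega> 3 X) e3)"
      unfolding c by (simp add: form_10_simps[OF \<omega>(1)] form_10_simps[OF \<omega>(2)] form_10_simps[OF \<omega>(3)] d)
  qed
  then have "dual_frame (\<omega> 1) (\<omega> 2) (\<omega> 3) e1 e2 e3"
    unfolding dual_frame_def using d \<omega> by blast
  then show ?thesis by (rule that)
qed

end

section \<open>Nilpotent Lie algebras with a complex structure\<close>

locale nilpotent_complex_lie_algebra =
  fixes br :: "'a::real_vector \<Rightarrow> 'a \<Rightarrow> 'a" and J :: "'a \<Rightarrow> 'a"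
  assumes lie: "lie_algebra br" and dim: "dim (UNIV :: 'a set) = 6"
    and nilpotent: "nilpotent_lie_algebra br" and cs: "complex_structure br J"
begin

sublocale almost_complex_6 J
  using cs dim
  by (intro almost_complex_6.intro almost_complex.intro almost_complex_6_axioms.intro)
     (simp_all add: complex_structure_def)

lemma bilinear_br: "bilinear br" using lie by (simp add: lie_algebra_def)

lemma br_simps [simp]:
  "br (X + Y) Z = br X Z + br Y Z" "br X (Y + Z) = br X Y + br X Z"
  "br (X - Y) Z = br X Z - br Y Z" "br X (Y - Z) = br X Y - br X Z"
  "br (- X) Y = - br X Y" "br X (- Y) = - br X Y"
  "br 0 X = 0" "br X 0 = 0" "br (c *\<^sub>R X) Y = c *\<^sub>R br X Y" "br X (c *\<^sub>R Y) = c *\<^sub>R br X Y"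
  "br X X = 0"
  using bilinear_br lie
  by (simp_all add: bilinear_ladd bilinear_radd bilinear_lsub bilinear_rsub bilinear_lneg bilinear_rneg
      bilinear_lzero bilinear_rzero bilinear_lmul bilinear_rmul lie_algebra_def)

lemma br_swap: "br X Y = - br Y X"
proof -
  have "br X Y + br Y X = br (X + Y) (X + Y)"
    unfolding br_simps(1,2) br_simps(11)[of X] br_simps(11)[of Y] by simp
  then have "br X Y + br Y X = 0" by simp
  then show ?thesis by (simp add: eq_neg_iff_add_eq_0)
qed

lemma jacobi: "br X (br Y Z) = br (br X Y) Z + br Y (br X Z)"
proof -
  have "br X (br Y Z) + br Y (br Z X) + br Z (br X Y) = 0"
    using lie by (auto simp: lie_algebra_def)
  moreover have "br Z X = - br X Z" "br Z (br X Y) = - br (br X Y) Z" by (rule br_swap)+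
  ultimately show ?thesis by (simp add: algebra_simps add_eq_0_iff)
qed

lemma integrable: "br (J X) (J Y) = J (br (J X) Y) + J (br X (J Y)) + br X Y"
  using cs by (simp add: complex_structure_def algebra_simps)

definition central :: "'a \<Rightarrow> bool" where "central z \<longleftrightarrow> (\<forall>U. br z U = 0)"

lemma centralD: "central z \<Longrightarrow> br z U = 0" "central z \<Longrightarrow> br U z = 0"
  using br_swap[of U z] by (auto simp: central_def)

definition derived :: "'a set" where "derived = span {br X Y | X Y. True}"

lemma br_derived: "br X Y \<in> derived"
  by (auto simp: derived_def intro!: span_base)

lemma derived_subset:
  assumes "subspace U" "\<And>X Y. br X Y \<in> U"
  shows "derived \<subseteq> U"
  unfolding derived_def using assms by (intro span_minimal) auto

lemma subspace_lower_central: "subspace (lower_central br k)"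
  by (cases k) (simp_all add: subspace_UNIV subspace_span)

lemma br_lower_central:
  assumes "X \<in> lower_central br k"
  shows "br U X \<in> lower_central br (Suc k)" "br X U \<in> lower_central br (Suc k)"
proof -
  show 1: "br U X \<in> lower_central br (Suc k)" using assms by (auto intro!: span_base)
  show "br X U \<in> lower_central br (Suc k)"
    using subspace_neg[OF subspace_lower_central 1] by (subst br_swap)
qed

lemma lower_central_vanishes: obtains k where "lower_central br k = {0}"
  using nilpotent by (auto simp: nilpotent_lie_algebra_def)

text \<open>If \<open>S\<close> is recovered, modulo the central set \<open>Z\<close>, from brackets with elements of \<open>S\<close>, then it lies
  modulo \<open>Z\<close> in every term of the lower central series, hence in the span of \<open>Z\<close>.  This is the form in
  which nilpotency excludes eigenvectors and surjectivity throughout the structure theory below.\<close>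

lemma nilpotent_flag:
  assumes S: "\<And>s. s \<in> S \<Longrightarrow> s \<in> span ({br U t | U t. t \<in> S} \<union> Z)"
    and Z: "\<And>z. z \<in> Z \<Longrightarrow> central z" and s: "s \<in> S"
  shows "s \<in> span Z"
proof -
  have *: "S \<subseteq> span (lower_central br k \<union> Z)" for k
  proof (induction k)
    case 0 then show ?case by simp
  next
    case (Suc k)
    have "br U t \<in> lower_central br (Suc k)" if "t \<in> S" for U t
    proof -
      have "t \<in> span (lower_central br k \<union> Z)" using that Suc by blast
      then show ?thesis
      proof (induction rule: span_induct_alt)
        case base
        show ?case using subspace_0[OF subspace_lower_central] by (simp del: lower_central.simps)
      next
        case (step c x y)
        from step(1) have "br U x \<in> lower_central br (Suc k)"
          using br_lower_central(1) Z subspace_0[OF subspace_lower_central[of "Suc k"]]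
          by (auto simp del: lower_central.simps simp: centralD)
        with step(2) show ?case
          using subspace_add[OF subspace_lower_central] subspace_scale[OF subspace_lower_central]
          by (simp del: lower_central.simps)
      qed
    qed
    then have "{br U t | U t. t \<in> S} \<union> Z \<subseteq> span (lower_central br (Suc k) \<union> Z)"
      by (auto intro!: span_base simp del: lower_central.simps)
    then show ?case using S span_minimal[OF _ subspace_span] by blast
  qed
  obtain k where "lower_central br k = {0}" by (rule lower_central_vanishes)
  with *[of k] s show ?thesis by (auto simp: span_insert_0)
qed

text \<open>An Engel-type statement: starting from \<open>s\<close>, keep bracketing as long as the result stays outside
  \<open>Z\<close>; the process stops because the \<open>k\<close>-fold brackets lie in the lower central series.\<close>

lemma nilpotent_pick:
  assumes S: "\<And>U s. s \<in> S \<Longrightarrow> br U s \<in> S" and Z: "subspace Z" and s: "s \<in> S" "s \<notin> Z"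
  obtains (pick) x where "x \<in> S" "x \<notin> Z" "\<And>U. br U x \<in> Z"
proof (rule ccontr)
  assume n: "\<not> thesis"
  have *: "\<exists>U. br U x \<notin> Z" if "x \<in> S" "x \<notin> Z" for x
    using n that(2) \<open>x \<in> S\<close> pick by blast
  have "\<exists>x. x \<in> S \<and> x \<notin> Z \<and> x \<in> lower_central br k" for k
  proof (induction k)
    case 0 then show ?case using s by auto
  next
    case (Suc k) then show ?case using * S br_lower_central(1) by blast
  qed
  moreover obtain k where "lower_central br k = {0}" by (rule lower_central_vanishes)
  ultimately show False using subspace_0[OF Z] by (metis singletonD)
qed

lemma br_span:
  assumes "\<And>x y. x \<in> A \<Longrightarrow> y \<in> B \<Longrightarrow> br x y \<in> W" "subspace W" "x \<in> span A" "y \<in> span B"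
  shows "br x y \<in> W"
  using assms(3)
proof (induction rule: span_induct_alt)
  case base then show ?case using assms(2) by (simp add: subspace_0)
next
  case (step c x x')
  have "br x y \<in> W" using assms(4)
  proof (induction rule: span_induct_alt)
    case base then show ?case using assms(2) by (simp add: subspace_0)
  next
    case (step d z z')
    then show ?case using assms(1)[OF \<open>x \<in> A\<close>, of z] assms(2) by (simp add: subspace_add subspace_scale)
  qed
  with step show ?case using assms(2) by (simp add: subspace_add subspace_scale)
qed

text \<open>This is the first step of Salamon's theorem, relative to a central complex subspace \<open>V\<close>.  Let
  \<open>U\<^sub>k = C\<^sup>k + J C\<^sup>k + V\<close> with \<open>C\<^sup>k\<close> the lower central series.  If \<open>U\<^sub>k\<close> is everything, integrability rewrites
  \<open>[Jc, Jd]\<close> for \<open>c, d \<in> C\<^sup>k\<close> through brackets in \<open>C\<^sup>k\<^sup>+\<^sup>1\<close>, so all brackets lie in \<open>U\<^sub>k\<^sub>+\<^sub>1\<close>.  Hence if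
  \<open>U\<^sub>1\<close> were everything, so would be all \<open>U\<^sub>k\<close>, contradicting \<open>C\<^sup>k = 0\<close> for large \<open>k\<close>.  A \<open>(1,0)\<close>-form that
  vanishes on \<open>U\<^sub>1\<close> is closed.\<close>

lemma closed_form_10_exists:
  assumes V: "subspace V" "\<And>x. x \<in> V \<Longrightarrow> J x \<in> V" "\<And>x. x \<in> V \<Longrightarrow> central x" "V \<noteq> UNIV"
  obtains \<eta> y where "form_10 J \<eta>" "\<eta> y = 1" "\<And>X Y. \<eta> (br X Y) = 0" "\<And>x. x \<in> V \<Longrightarrow> \<eta> x = 0"
proof -
  define U where "U k = span (lower_central br k \<union> J ` lower_central br k \<union> V)" for k
  have J_U: "J x \<in> U k" if "x \<in> U k" for x k
    unfolding U_def
  proof (rule J_span)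
    show "x \<in> span (lower_central br k \<union> J ` lower_central br k \<union> V)" using that by (simp add: U_def)
  next
    fix x assume "x \<in> lower_central br k \<union> J ` lower_central br k \<union> V"
    then consider "x \<in> lower_central br k" | y where "x = J y" "- y \<in> lower_central br k" | "x \<in> V"
      using subspace_neg[OF subspace_lower_central] by blast
    then show "J x \<in> span (lower_central br k \<union> J ` lower_central br k \<union> V)"
      using V(2) by cases (auto intro: span_base)
  qed
  have sub: "subspace (U k)" for k by (simp add: U_def subspace_span)
  have CU: "x \<in> lower_central br k \<Longrightarrow> x \<in> U k" "x \<in> V \<Longrightarrow> x \<in> U k" for x k
    unfolding U_def by (auto intro: span_base)
  have step: "br X Y \<in> U (Suc k)" if "U k = UNIV" for X Y k
  proof (rule br_span[OF _ sub])
    show "X \<in> span (lower_central br k \<union> J ` lower_central br k \<union> V)"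
      "Y \<in> span (lower_central br k \<union> J ` lower_central br k \<union> V)" using that by (auto simp: U_def)
    fix x y
    assume x: "x \<in> lower_central br k \<union> J ` lower_central br k \<union> V"
      and y: "y \<in> lower_central br k \<union> J ` lower_central br k \<union> V"
    note C = br_lower_central[THEN CU(1)]
    have 0: "0 \<in> U (Suc k)" using sub by (rule subspace_0)
    show "br x y \<in> U (Suc k)"
    proof (cases "x \<in> V \<or> y \<in> V \<or> x \<in> lower_central br k \<or> y \<in> lower_central br k")
      case True then show ?thesis using C V(3) centralD 0 by fastforce
    next
      case False
      then obtain c d where "x = J c" "y = J d" "c \<in> lower_central br k" "d \<in> lower_central br k"
        using x y by auto
      then show ?thesis using C J_U sub by (simp only: integrable subspace_add)
    qed
  qed
  have "U 1 \<noteq> UNIV"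
  proof
    assume 1: "U 1 = UNIV"
    have all: "U k = UNIV" for k
    proof (induction k)
      case 0 then show ?case by (simp add: U_def)
    next
      case (Suc k)
      have "lower_central br 1 \<subseteq> U (Suc k)"
        unfolding One_nat_def lower_central.simps using step[OF Suc] sub by (intro span_minimal) auto
      then have "lower_central br 1 \<union> J ` lower_central br 1 \<union> V \<subseteq> U (Suc k)"
        using J_U CU(2) by auto
      then have "U 1 \<subseteq> U (Suc k)" unfolding U_def[of 1] using sub by (rule span_minimal)
      then show ?case using 1 by auto
    qed
    obtain k where k: "lower_central br k = {0}" by (rule lower_central_vanishes)
    have "U k \<subseteq> V" unfolding U_def k using V(1) by (intro span_minimal) (auto simp: subspace_0)
    then show False using all[of k] V(4) by auto
  qed
  then obtain y where "y \<notin> U 1" by auto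
  then obtain \<eta> where \<eta>: "form_10 J \<eta>" "\<And>x. x \<in> U 1 \<Longrightarrow> \<eta> x = 0" "\<eta> y = 1"
    using form_10_exists[OF sub J_U] by metis
  have "\<eta> (br X Y) = 0" for X Y
    using \<eta>(2)[OF step[of 0, unfolded One_nat_def[symmetric]]] by (simp add: U_def)
  then show ?thesis using that[of \<eta> y] \<eta> CU(2) by blast
qed

lemma central_in_derived_exists:
  assumes "br X Y \<noteq> 0"
  obtains z where "z \<noteq> 0" "central z" "z \<in> derived"
proof -
  have "\<And>U s. s \<in> derived \<Longrightarrow> br U s \<in> derived" by (rule br_derived)
  from nilpotent_pick[OF this subspace_single_0 br_derived[of X Y]] assms
  obtain z where "z \<in> derived" "z \<noteq> 0" "\<And>U. br U z = 0" by auto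
  then show ?thesis using that[of z] br_swap[of z] by (simp add: central_def)
qed

section \<open>Adapted frames and nilpotent complex structures\<close>

text \<open>With \<open>V = \<langle>X, JX\<rangle>\<close> and \<open>P = ker w1\<close>, the conditions say that \<open>V\<close> is central, \<open>[\<gg>, \<gg>] \<subseteq> P\<close> and
  \<open>[P, \<gg>] \<subseteq> V\<close>.\<close>

definition adapted_frame ::
  "('a \<Rightarrow> complex) \<Rightarrow> ('a \<Rightarrow> complex) \<Rightarrow> ('a \<Rightarrow> complex) \<Rightarrow> 'a \<Rightarrow> 'a \<Rightarrow> 'a \<Rightarrow> bool" where
  "adapted_frame w1 w2 w3 Y p X \<longleftrightarrow> dual_frame w1 w2 w3 Y p X \<and> central X \<and> central (J X) \<and>
     (\<forall>U V. w1 (br U V) = 0) \<and> (\<forall>U V. w1 U = 0 \<longrightarrow> w2 (br U V) = 0)"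

lemma adapted_frame_central:
  assumes "adapted_frame w1 w2 w3 Y p X" "w1 Z = 0" "w2 Z = 0"
  shows "central Z"
proof -
  have "Z = cmul (w3 Z) X"
    using dual_frame_expand[of w1 w2 w3 Y p X Z] assms by (simp add: adapted_frame_def)
  then have "central (cmul (w3 Z) X) \<Longrightarrow> central Z" by simp
  then show ?thesis using assms(1) by (simp add: cmul_def central_def adapted_frame_def)
qed

lemma span_pair_mem_iff:
  assumes "dual_frame w1 w2 w3 Y p X"
  shows "Z \<in> span {X, J X} \<longleftrightarrow> w1 Z = 0 \<and> w2 Z = 0"
proof
  note s = dual_frame_simps[OF assms]
  assume "Z \<in> span {X, J X}"
  then show "w1 Z = 0 \<and> w2 Z = 0"
    by (induction rule: span_induct_alt)
       (auto simp: form_10_simps[OF s(1)] form_10_simps[OF s(2)] s)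
next
  assume "w1 Z = 0 \<and> w2 Z = 0"
  then have "Z = cmul (w3 Z) X" using dual_frame_expand[OF assms, of Z] by simp
  moreover have "cmul (w3 Z) X \<in> span {X, J X}"
    unfolding cmul_def by (intro span_add span_scale span_base) auto
  ultimately show "Z \<in> span {X, J X}" by simp
qed

lemma adapted_frame_facts:
  assumes "adapted_frame w1 w2 w3 Y p X"
  shows "dual_frame w1 w2 w3 Y p X" "central X" "central (J X)" "w1 (br U V) = 0"
    "w1 U = 0 \<Longrightarrow> w2 (br U V) = 0" "w1 V = 0 \<Longrightarrow> w2 (br U V) = 0"
proof -
  show 1: "dual_frame w1 w2 w3 Y p X" "central X" "central (J X)" "w1 (br U V) = 0"
    "w1 U = 0 \<Longrightarrow> w2 (br U V) = 0" for U V using assms by (auto simp: adapted_frame_def)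
  show "w1 V = 0 \<Longrightarrow> w2 (br U V) = 0"
    using 1(5)[of V U] by (subst br_swap) (simp add: form_10_simps[OF dual_frame_simps(2)[OF 1(1)]])
qed

text \<open>Take a closed \<open>(1,0)\<close>-form that vanishes on \<open>V = \<langle>X, JX\<rangle>\<close>.  Its kernel \<open>P\<close> is an ideal, so it contains
  \<open>x \<notin> V\<close> with \<open>[\<gg>, x] \<subseteq> V\<close>.  Modulo \<open>V\<close>, integrability then gives \<open>[Jy, Jx] = J[y, Jx]\<close>; if this were
  nonzero, \<open>[y, Jx]\<close> and \<open>[Jy, Jx]\<close> would span the plane of \<open>x\<close> and \<open>Jx\<close> and so recover \<open>Jx\<close>,
  contradicting nilpotency.\<close>

lemma adapted_frame_exists:
  assumes X: "X \<noteq> 0" "central X" "central (J X)"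
  obtains w1 w2 w3 Y p where "adapted_frame w1 w2 w3 Y p X"
proof -
  let ?V = "span {X, J X}"
  have c1: "complex_independent {X, J X}" "card {X, J X} = 2"
    using complex_independent_insert[of "{}" X] X(1) by (auto simp: complex_independent_def independent_empty)
  have JV: "\<And>x. x \<in> ?V \<Longrightarrow> J x \<in> ?V" using c1(1) by (auto simp: complex_independent_def)
  have cV: "central x" if "x \<in> ?V" for x
    using that by (induction rule: span_induct_alt) (use X in \<open>auto simp: central_def\<close>)
  have nV: "?V \<noteq> UNIV" using complex_independent_card(2)[OF c1(1)] c1(2) by simp
  obtain \<eta> y where \<eta>: "form_10 J \<eta>" "\<eta> y = 1" "\<And>X Y. \<eta> (br X Y) = 0" "\<And>x. x \<in> ?V \<Longrightarrow> \<eta> x = 0"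
    using closed_form_10_exists[OF subspace_span JV cV nV] by blast
  note \<eta>s = form_10_simps[OF \<eta>(1)]
  have \<eta>X: "\<eta> X = 0" using \<eta>(4)[of X] by (simp add: span_base)
  obtain p w2' w3' where f': "dual_frame \<eta> w2' w3' y p X"
    using dual_frame_with_first_last[OF \<eta>(1,2) \<eta>X X(1)] by blast
  have p: "p \<in> {U. \<eta> U = 0}" "p \<notin> ?V"
    using dual_frame_simps[OF f'] span_pair_mem_iff[OF f', of p] by auto
  obtain x where x: "x \<in> {U. \<eta> U = 0}" "x \<notin> ?V" "\<And>U. br U x \<in> ?V"
    by (rule nilpotent_pick[of "{U. \<eta> U = 0}" ?V p]) (use \<eta>(3) p in \<open>auto simp: subspace_span\<close>)
  obtain w2 w3 where f: "dual_frame \<eta> w2 w3 y x X"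
    using dual_frame_with_first[OF \<eta>(1,2) _ \<eta>X X(1) x(2)] x(1) by blast
  note s = dual_frame_simps[OF f]
  note w2s = form_10_simps[OF s(2)]
  note memV = span_pair_mem_iff[OF f]
  have w2x: "w2 (br U x) = 0" "w2 (br x U) = 0" for U
  proof -
    show 1: "w2 (br U x) = 0" using x(3) memV by simp
    show "w2 (br x U) = 0" using 1 by (subst br_swap) (simp add: w2s)
  qed
  define c where "c = w2 (br y (J x))"
  have c': "w2 (br (J y) (J x)) = \<i> * c"
    by (simp add: integrable w2s w2x c_def)
  have c0: "c = 0"
  proof (rule ccontr)
    assume c: "c \<noteq> 0"
    define a where "a = Re (\<i> / c)"
    define b where "b = Im (\<i> / c)"
    have ab: "(of_real a + \<i> * of_real b) * c = \<i>"
      using c unfolding a_def b_def complex_eq[symmetric] by simp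
    let ?S = "span ({br U t | U t. t \<in> {J x}} \<union> {X, J X})"
    have "J x - a *\<^sub>R br y (J x) - b *\<^sub>R br (J y) (J x) \<in> ?V"
      unfolding memV using ab by (simp add: w2s form_10_simps[OF s(1)] \<eta>(3) s c' c_def[symmetric] algebra_simps)
    then have "J x - a *\<^sub>R br y (J x) - b *\<^sub>R br (J y) (J x) \<in> ?S"
      using span_mono[of "{X, J X}"] by blast
    moreover have "a *\<^sub>R br y (J x) + b *\<^sub>R br (J y) (J x) \<in> ?S"
      by (intro span_add span_scale span_base) auto
    ultimately have "(J x - a *\<^sub>R br y (J x) - b *\<^sub>R br (J y) (J x)) + (a *\<^sub>R br y (J x) + b *\<^sub>R br (J y) (J x)) \<in> ?S"
      by (rule span_add)
    then have "J x \<in> ?S" by simp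
    then have "J x \<in> ?V" using nilpotent_flag[of "{J x}" "{X, J X}" "J x"] X by blast
    then show False by (simp add: memV w2s s)
  qed
  have w2Jx: "w2 (br (J x) V) = 0" for V
  proof -
    have "w2 (br (J x) V) = w2 (br (J x) (cmul (\<eta> V) y + cmul (w2 V) x + cmul (w3 V) X))"
      using dual_frame_expand[OF f, of V] by simp
    also have "\<dots> = 0"
      using c0 c' br_swap[of "J x" y] br_swap[of "J x" "J y"]
      by (simp add: cmul_def w2s w2x centralD[OF X(2)] centralD[OF X(3)] c_def)
    finally show ?thesis .
  qed
  have "w2 (br U V) = 0" if "\<eta> U = 0" for U V
  proof -
    have "w2 (br U V) = w2 (br (cmul (\<eta> U) y + cmul (w2 U) x + cmul (w3 U) X) V)"
      using dual_frame_expand[OF f, of U] by simp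
    then show ?thesis using that
      by (simp add: cmul_def w2s w2x w2Jx centralD[OF X(2)] centralD[OF X(3)])
  qed
  then have "adapted_frame \<eta> w2 w3 y x X" using f X \<eta>(3) by (simp add: adapted_frame_def)
  then show ?thesis by (rule that)
qed

lemma br_expand:
  assumes f: "dual_frame w1 w2 w3 Y p X" and c: "central X" "central (J X)"
  shows "br U V =
      (Re (w1 U) * Im (w1 V) - Im (w1 U) * Re (w1 V)) *\<^sub>R br Y (J Y)
    + (Re (w1 U) * Re (w2 V) - Re (w2 U) * Re (w1 V)) *\<^sub>R br Y p
    + (Re (w1 U) * Im (w2 V) - Im (w2 U) * Re (w1 V)) *\<^sub>R br Y (J p)
    + (Im (w1 U) * Re (w2 V) - Re (w2 U) * Im (w1 V)) *\<^sub>R br (J Y) p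
    + (Im (w1 U) * Im (w2 V) - Im (w2 U) * Im (w1 V)) *\<^sub>R br (J Y) (J p)
    + (Re (w2 U) * Im (w2 V) - Im (w2 U) * Re (w2 V)) *\<^sub>R br p (J p)"
proof -
  have "br U V = br (cmul (w1 U) Y + cmul (w2 U) p + cmul (w3 U) X) (cmul (w1 V) Y + cmul (w2 V) p + cmul (w3 V) X)"
    using dual_frame_expand[OF f, of U] dual_frame_expand[OF f, of V] by simp
  then show ?thesis
    using br_swap[of "J Y" Y] br_swap[of p Y] br_swap[of "J p" Y] br_swap[of p "J Y"] br_swap[of "J p" "J Y"] br_swap[of "J p" p]
    by (simp add: cmul_def centralD[OF c(1)] centralD[OF c(2)] algebra_simps)
qed

text \<open>All brackets involving \<open>V\<close> vanish, so \<open>dw3\<close> only involves \<open>w1\<close>, \<open>w2\<close> and their conjugates; all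
  brackets involving \<open>P\<close> have no \<open>w2\<close>-component, so \<open>dw2\<close> only involves \<open>w1\<close> and its conjugate.\<close>

lemma nilpotent_if_adapted_frame:
  assumes "adapted_frame w1 w2 w3 Y p X"
  shows "nilpotent_complex_structure br J"
proof -
  have f: "dual_frame w1 w2 w3 Y p X" and c: "central X" "central (J X)"
    using assms by (auto simp: adapted_frame_def)
  note s = dual_frame_simps[OF f]
  define \<omega> where "\<omega> j = (if j = 1 then w1 else if j = 2 then w2 else w3)" for j :: nat
  have \<omega>: "\<omega> 1 = w1" "\<omega> 2 = w2" "\<omega> 3 = w3" by (simp_all add: \<omega>_def)
  have b: "basis_10 J 3 \<omega>" using dual_frame_basis_10[of \<omega>] f unfolding \<omega> by blast
  have d1: "ce_d1 br (\<omega> 1) = (\<lambda>_ _. 0)"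
    using assms by (intro ext) (simp add: \<omega> ce_d1_def adapted_frame_def)
  have re: "complex_of_real (Re x) = (x + cnj x) / 2" and im: "complex_of_real (Im x) = - \<i> * (x - cnj x) / 2" for x
    by (simp_all add: complex_eq_iff)
  have d2: "in_ext2 \<omega> 1 (ce_d1 br (\<omega> 2))"
  proof -
    have z: "w2 (br Y p) = 0" "w2 (br Y (J p)) = 0" "w2 (br (J Y) p) = 0" "w2 (br (J Y) (J p)) = 0"
      "w2 (br p (J p)) = 0"
      using assms s br_swap[of Y p] br_swap[of Y "J p"] br_swap[of "J Y" p] br_swap[of "J Y" "J p"]
      by (simp_all add: adapted_frame_def form_10_simps[OF s(1)] form_10_simps[OF s(2)])
    have *: "ce_d1 br w2 U V = (- \<i> / 2 * w2 (br Y (J Y))) * wedge11 w1 (conj_form w1) U V" for U V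
      unfolding ce_d1_def br_expand[OF f c, of U V] wedge11_def conj_form_def
      by (simp add: form_10_simps[OF s(2)] z re im) (simp add: field_simps)
    show ?thesis unfolding in_ext2_def \<omega>
      by (rule exI[of _ "\<lambda>_ _. 0"], rule exI[of _ "\<lambda>_ _. - \<i> / 2 * w2 (br Y (J Y))"],
          rule exI[of _ "\<lambda>_ _. 0"]) (simp add: \<omega> *)
  qed
  have d3: "in_ext2 \<omega> 2 (ce_d1 br (\<omega> 3))"
  proof -
    define A B C D E F where "A = - w3 (br Y p)" and "B = - w3 (br Y (J p))" and "C = - w3 (br (J Y) p)"
      and "D = - w3 (br (J Y) (J p))" and "E = \<i> / 2 * (- w3 (br Y (J Y)))" and "F = \<i> / 2 * (- w3 (br p (J p)))"
    \<comment> \<open>The coefficients of the mixed terms come from solving the four real equations for the values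
      at \<open>(Y, p), (Y, Jp), (JY, p), (JY, Jp)\<close>.\<close>
    have "ce_d1 br w3 U V =
        (A - \<i> * B - \<i> * C - D) / 4 * wedge11 w1 w2 U V
      + (A + \<i> * B - \<i> * C + D) / 4 * wedge11 w1 (conj_form w2) U V
      - (A - \<i> * B + \<i> * C + D) / 4 * wedge11 w2 (conj_form w1) U V
      + (A + \<i> * B + \<i> * C - D) / 4 * wedge11 (conj_form w1) (conj_form w2) U V
      + E * wedge11 w1 (conj_form w1) U V + F * wedge11 w2 (conj_form w2) U V" for U V
      unfolding ce_d1_def br_expand[OF f c, of U V] wedge11_def conj_form_def A_def B_def C_def D_def E_def F_def
      by (simp add: form_10_simps[OF s(3)] re im) (simp add: field_simps)
    then have "\<exists>a b b' c e f. \<forall>U V. ce_d1 br w3 U V = a * wedge11 w1 w2 U V + b * wedge11 w1 (conj_form w2) U V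
      - b' * wedge11 w2 (conj_form w1) U V + c * wedge11 (conj_form w1) (conj_form w2) U V
      + e * wedge11 w1 (conj_form w1) U V + f * wedge11 w2 (conj_form w2) U V" by blast
    then obtain a b b' c e f where *: "\<And>U V. ce_d1 br w3 U V = a * wedge11 w1 w2 U V + b * wedge11 w1 (conj_form w2) U V
      - b' * wedge11 w2 (conj_form w1) U V + c * wedge11 (conj_form w1) (conj_form w2) U V
      + e * wedge11 w1 (conj_form w1) U V + f * wedge11 w2 (conj_form w2) U V" by blast
    have I: "{1..2} = {1, 2 :: nat}" by auto
    show ?thesis unfolding in_ext2_def \<omega>
      by (rule exI[of _ "\<lambda>k l. if k = 1 \<and> l = 2 then a else 0"],
          rule exI[of _ "\<lambda>k l. if k = 1 then (if l = 2 then b else e) else (if l = 1 then - b' else f)"],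
          rule exI[of _ "\<lambda>k l. if k = 1 \<and> l = 2 then c else 0"]) (simp add: \<omega> * I)
  qed
  have "{2..3} = {2, 3 :: nat}" by auto
  then show ?thesis unfolding nilpotent_complex_structure_def
    using b d1 d2 d3 dim by (intro exI[of _ 3] exI[of _ \<omega>]) (simp add: numeral_eq_Suc One_nat_def)
qed

text \<open>The last vector of the frame dual to the basis of \<open>(1,0)\<close>-forms works, since no differential
  involves the last form.\<close>

lemma central_line_if_nilpotent:
  assumes "nilpotent_complex_structure br J"
  obtains X where "X \<noteq> 0" "central X" "central (J X)"
proof -
  obtain n \<omega> where n: "dim (UNIV :: 'a set) = 2 * n" and b: "basis_10 J n \<omega>"
    and d1: "ce_d1 br (\<omega> 1) = (\<lambda>_ _. 0)" and d: "\<And>j. j \<in> {2..n} \<Longrightarrow> in_ext2 \<omega> (j - 1) (ce_d1 br (\<omega> j))"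
    using assms by (auto simp: nilpotent_complex_structure_def)
  have [simp]: "n = 3" using n dim by simp
  obtain e1 e2 e3 where f: "dual_frame (\<omega> 1) (\<omega> 2) (\<omega> 3) e1 e2 e3"
    by (rule basis_10_dual_frame[of \<omega>]) (use b in simp)
  note s = dual_frame_simps[OF f]
  have d': "in_ext2 \<omega> k (ce_d1 br (\<omega> j))" if "j = k + 1" "1 \<le> k" "k \<le> 2" for j k
    using d[of j] that by simp
  have d2: "in_ext2 \<omega> 1 (ce_d1 br (\<omega> 2))" by (rule d') simp_all
  have d3: "in_ext2 \<omega> 2 (ce_d1 br (\<omega> 3))" by (rule d') simp_all
  have "{1..2} = {1, 2 :: nat}" by auto
  then have z: "ce_d1 br (\<omega> 1) Z U = 0" "ce_d1 br (\<omega> 2) Z U = 0" "ce_d1 br (\<omega> 3) Z U = 0"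
    if "\<omega> 1 Z = 0" "\<omega> 2 Z = 0" for Z U
    using d1 d2 d3 that by (auto simp: in_ext2_def wedge11_def conj_form_def)
  have "central Z" if "\<omega> 1 Z = 0" "\<omega> 2 Z = 0" for Z
    unfolding central_def
  proof
    show "br Z U = 0" for U
      using z[OF that, of U] by (intro dual_frame_eqI[OF f])
        (simp_all add: ce_d1_def form_10_simps[OF s(1)] form_10_simps[OF s(2)] form_10_simps[OF s(3)])
  qed
  from this[of e3] this[of "J e3"] s show ?thesis
    by (intro that[of e3]) (auto simp: form_10_simps[OF s(1)] form_10_simps[OF s(2)] form_10_simps[OF s(3)])
qed

section \<open>Structure of non-nilpotent complex structures\<close>

lemma span_pair_cmul:
  assumes "Z \<in> span {X, J X}"
  obtains w where "Z = cmul w X"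
proof -
  obtain k where "Z - k *\<^sub>R X \<in> span {J X}" using assms by (auto simp: span_breakdown_eq)
  then obtain l where "Z - k *\<^sub>R X = l *\<^sub>R J X" by (auto simp: span_singleton)
  then have "Z = cmul (Complex k l) X" by (simp add: cmul_def algebra_simps)
  then show ?thesis by (rule that)
qed

lemma cmul_span_pair:
  assumes "A \<in> span T" "J A \<in> span T"
  shows "cmul w A \<in> span T"
  using assms by (simp add: cmul_def span_add span_scale)

text \<open>For \<open>X\<close> central, integrability says that \<open>D = ad JX\<close> commutes with \<open>J\<close>.  The complex line \<open>\<langle>X, JX\<rangle>\<close>
  lies in the kernel of \<open>D\<close>, but it meets the image only in \<open>0\<close>, as \<open>D U = JX\<close> would contradict nilpotency.  So \<open>D\<close>
  has complex rank one with \<open>D\<^sup>2 = 0\<close>.  Choosing \<open>X\<close> in the derived algebra places both \<open>X\<close> and the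
  image of \<open>D\<close>, hence all of \<open>ker D\<close>, in the kernel of a closed \<open>(1,0)\<close>-form; thus \<open>D\<close>
  kills every bracket.  Write \<open>Z = D Y\<close>.  The brackets of \<open>Y, JY\<close> with \<open>Z, JZ\<close> are then
  restricted by integrability and the Jacobi identity, and three applications of lemma
  \<open>nilpotent_flag\<close> leave only a real multiple of \<open>X\<close>, which is nonzero since \<open>Z\<close> and \<open>JZ\<close> are not both
  central.\<close>

lemma no_central_line_structure:
  assumes noline: "\<And>X. central X \<Longrightarrow> central (J X) \<Longrightarrow> X = 0"
  obtains X Y Z a k l where "central X" "X \<noteq> 0" "X \<in> derived" "Z \<noteq> 0" "a \<noteq> 0"
    "br (J X) Y = Z" "br (J X) (J Y) = J Z" "br (J X) Z = 0" "br (J X) (J Z) = 0" "br Z (J Z) = 0"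
    "br Y (J Z) = 0" "br (J Y) Z = 0" "br Y Z = a *\<^sub>R X" "br (J Y) (J Z) = a *\<^sub>R X"
    "br Y (J Y) = cmul k Z + cmul l X"
proof -
  obtain u0 v0 where uv: "br u0 v0 \<noteq> 0"
  proof (rule ccontr)
    assume "\<not> thesis"
    then have "central X" for X using that by (auto simp: central_def)
    then have "X = 0" for X :: 'a using noline by blast
    then show False using complex_independent_card(2)[of "{}"]
      by (auto simp: complex_independent_def independent_empty)
  qed
  obtain X where X: "X \<noteq> 0" "central X" "X \<in> derived" using central_in_derived_exists[OF uv] by blast
  note cX [simp] = centralD[OF X(2)]
  have DJ: "br (J X) (J U) = J (br (J X) U)" for U using integrable[of X U] by simp
  have Dc: "br (J X) (cmul z U) = cmul z (br (J X) U)" for z U by (simp add: cmul_def DJ)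
  obtain Y where Y: "br (J X) Y \<noteq> 0" using noline[OF X(2)] X(1) by (auto simp: central_def)
  define Z where "Z = br (J X) Y"
  obtain \<eta> y where \<eta>: "form_10 J \<eta>" "\<eta> y = 1" "\<And>U V. \<eta> (br U V) = 0"
    by (rule closed_form_10_exists[of "{0}"]) (use X(1) in \<open>auto simp: central_def\<close>)
  note \<eta>s = form_10_simps[OF \<eta>(1)]
  have "derived \<subseteq> {U. \<eta> U = 0}"
    by (rule derived_subset) (auto simp: \<eta> \<eta>s subspace_def)
  then have \<eta>X: "\<eta> X = 0" using X(3) by auto
  have \<eta>Z: "\<eta> Z = 0" by (simp add: Z_def \<eta>)
  have noimg: "br (J X) U \<noteq> cmul w X" if "w \<noteq> 0" for U w
  proof
    assume "br (J X) U = cmul w X"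
    then have "br (J X) (cmul (\<i> / w) U) = cmul \<i> X" using that by (simp add: Dc cmul_cmul)
    then have *: "br (cmul (\<i> / w) U) (J X) = - J X" using br_swap[of "cmul (\<i> / w) U" "J X"]
      by (simp add: cmul_def)
    have "- br (cmul (\<i> / w) U) (J X) \<in> span ({br U t |U t. t \<in> {J X}} \<union> {})"
      by (intro span_neg span_base) auto
    then have "J X \<in> span {}" using nilpotent_flag[of "{J X}" "{}" "J X"] * by auto
    then have "J (J X) = 0" by simp
    then show False using X(1) by (simp only: JJ) simp
  qed
  have ZX: "Z \<notin> span {X, J X}"
  proof
    assume "Z \<in> span {X, J X}"
    then obtain w where w: "Z = cmul w X" by (rule span_pair_cmul)
    then show False using noimg[of w Y] Y by (cases "w = 0") (auto simp: Z_def)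
  qed
  obtain w2 w3 where f: "dual_frame \<eta> w2 w3 y Z X"
    using dual_frame_with_first[OF \<eta>(1,2) \<eta>Z \<eta>X X(1) ZX] by blast
  note s = dual_frame_simps[OF f]
  have DZ: "br (J X) Z = 0"
  proof -
    define Z' where "Z' = br (J X) Z"
    define a b where "a = w2 Z'" and "b = w3 Z'"
    have Z': "Z' = cmul a Z + cmul b X"
      using dual_frame_expand[OF f, of Z'] \<eta>(3) by (simp add: a_def b_def Z'_def)
    have "a = 0"
    proof (rule ccontr)
      assume a: "a \<noteq> 0"
      have DX: "br (J X) X = 0" by simp
      have *: "br (J X) Z' = cmul a Z'"
        unfolding Z'_def using Z'[unfolded Z'_def] DX Dc br_simps(2) cmul_simps(3) 
        by (metis add.right_neutral)
      let ?S = "span ({br U t |U t. t \<in> {Z', J Z'}} \<union> {})"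
      have "br (J X) Z' \<in> ?S" "br (J X) (J Z') \<in> ?S" by (auto intro!: span_base)
      then have "cmul a Z' \<in> ?S" "J (cmul a Z') \<in> ?S" by (simp_all only: DJ *)
      then have "cmul (inverse a) (cmul a Z') \<in> ?S" "cmul (\<i> * inverse a) (cmul a Z') \<in> ?S"
        by (simp_all only: cmul_span_pair)
      then have "Z' \<in> ?S" "J Z' \<in> ?S"
        by (simp_all only: cmul_inverse[OF a])
      then have "Z' \<in> span {}" using nilpotent_flag[of "{Z', J Z'}" "{}" Z'] by blast
      then have "w2 Z' = 0" by (simp add: form_10_simps[OF s(2)])
      then show False using a by (simp add: a_def)
    qed
    then have "Z' = cmul b X" using Z' by simp
    then show ?thesis using noimg[of b Z] by (cases "b = 0") (auto simp: Z'_def)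
  qed
  have DP: "br (J X) U = 0" if "\<eta> U = 0" for U
  proof -
    have "br (J X) U = br (J X) (cmul (\<eta> U) y + cmul (w2 U) Z + cmul (w3 U) X)"
      using dual_frame_expand[OF f, of U] by simp
    then show ?thesis using that DZ by (simp add: Dc)
  qed
  have \<eta>Y: "\<eta> Y \<noteq> 0" using DP Y by auto
  define v1 where "v1 U = \<eta> U / \<eta> Y" for U
  have "form_10 J v1" unfolding form_10_def v1_def
    by (auto intro!: linearI simp: \<eta>s add_divide_distrib scaleR_conv_of_real)
  then obtain v2 v3 where v: "dual_frame v1 v2 v3 Y Z X"
    using dual_frame_with_first[of v1 Y Z X] \<eta>Y \<eta>Z \<eta>X X(1) ZX by (auto simp: v1_def)
  note vs = dual_frame_simps[OF v]
  have v1br: "v1 (br U V) = 0" for U V by (simp add: v1_def \<eta>(3))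
  have expand: "U = cmul (v2 U) Z + cmul (v3 U) X" if "v1 U = 0" for U
    using dual_frame_expand[OF v, of U] that by simp
  note v2s = form_10_simps[OF vs(2)] and v3s = form_10_simps[OF vs(3)] and v1s = form_10_simps[OF vs(1)]
  have Z: "br (J X) Y = Z" "br (J X) (J Y) = J Z" "br (J X) Z = 0" "br (J X) (J Z) = 0"
    by (simp_all add: Z_def DJ DZ[unfolded Z_def])
  have Z0: "Z \<noteq> 0" using Y by (simp add: Z_def)
  \<comment> \<open>\<open>D\<close> annihilates \<open>[Y, JY]\<close> and \<open>[Y, JZ]\<close>; expanding by the Jacobi identity gives two relations.\<close>
  define A2 A3 where "A2 = br Y Z" and "A3 = br Y (J Z)"
  have "0 = br (J X) (br Y (J Y))" using DP \<eta>(3) by simp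
  also have "\<dots> = br Z (J Y) + br Y (J Z)" by (subst jacobi) (simp add: Z)
  finally have JYZ: "br (J Y) Z = A3" using br_swap[of "J Y" Z] by (simp add: A3_def add_eq_0_iff2)
  have JYJZ: "br (J Y) (J Z) = A2 + 2 *\<^sub>R J A3"
    using JYZ by (simp add: integrable A2_def A3_def scaleR_2 algebra_simps)
  have "0 = br (J X) (br Y (J Z))" using DP \<eta>(3) by simp
  also have "\<dots> = br Z (J Z)" by (subst jacobi) (simp add: Z)
  finally have ZJZ: "br Z (J Z) = 0" by simp
  have nspan: "u \<notin> span {X}" if "v2 u \<noteq> 0 \<or> Im (v3 u) \<noteq> 0" for u
  proof
    assume "u \<in> span {X}"
    then obtain c where "u = c *\<^sub>R X" by (auto simp: span_singleton)
    then show False using that by (simp add: v2s v3s vs)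
  qed
  \<comment> \<open>\<open>Im (v3 q)\<close> is the coefficient of \<open>JX\<close>.  A bracket with a nonzero such coefficient would, together
    with \<open>Z = - [Y, JX]\<close> and \<open>JZ = - [JY, JX]\<close>, recover the set \<open>{JX, Z, JZ}\<close> modulo \<open>X\<close>.\<close>
  have ImA: "Im (v3 q) = 0" if q: "q \<in> span ({br U t |U t. t \<in> {J X, Z, J Z}} \<union> {X})" "v1 q = 0" for q
  proof (rule ccontr)
    assume i: "Im (v3 q) \<noteq> 0"
    let ?S = "span ({br U t |U t. t \<in> {J X, Z, J Z}} \<union> {X})"
    have "br Y (J X) \<in> ?S" "br (J Y) (J X) \<in> ?S" by (auto intro!: span_base)
    then have "- br Y (J X) \<in> ?S" "- br (J Y) (J X) \<in> ?S" by (simp_all only: span_neg)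
    then have z: "Z \<in> ?S" "J Z \<in> ?S"
      using br_swap[of "J X" Y] br_swap[of "J X" "J Y"] Z by simp_all
    have x: "X \<in> ?S" by (auto intro: span_base)
    have "(1 / Im (v3 q)) *\<^sub>R (q - cmul (v2 q) Z - Re (v3 q) *\<^sub>R X) \<in> ?S"
      by (intro span_scale span_diff q cmul_span_pair z x)
    moreover have "q - cmul (v2 q) Z - Re (v3 q) *\<^sub>R X = Im (v3 q) *\<^sub>R J X"
      using expand[OF q(2)] by (simp add: cmul_def[of "v3 q"] algebra_simps)
    ultimately have jx: "J X \<in> ?S" using i by simp
    have "J X \<in> span {X}"
      by (rule nilpotent_flag[of "{J X, Z, J Z}" "{X}"]) (use z jx X in auto)
    then show False using nspan[of "J X"] by (simp add: v3s vs)
  qed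
  have "A2 \<in> span ({br U t |U t. t \<in> {J X, Z, J Z}} \<union> {X})"
    "A3 \<in> span ({br U t |U t. t \<in> {J X, Z, J Z}} \<union> {X})"
    "A2 + 2 *\<^sub>R J A3 \<in> span ({br U t |U t. t \<in> {J X, Z, J Z}} \<union> {X})"
    unfolding JYJZ[symmetric] by (auto simp: A2_def A3_def intro!: span_base)
  from this[THEN ImA] have Im: "Im (v3 A2) = 0" "Im (v3 A3) = 0" "Re (v3 A3) = 0"
    unfolding JYJZ[symmetric] v1br unfolding JYJZ by (simp_all add: A2_def A3_def v1br v3s)
  \<comment> \<open>The coefficient of \<open>JX\<close> in \<open>J A3\<close> is the coefficient of \<open>X\<close> in \<open>A3\<close>, so \<open>A3\<close> has no part in \<open>\<langle>X, JX\<rangle>\<close>.\<close>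
  then have A3: "A3 = cmul (v2 A3) Z" using expand[of A3] by (simp add: A3_def v1br cmul_def[of "v3 _"])
  have A30: "A3 = 0"
  proof (rule ccontr)
    assume n: "A3 \<noteq> 0"
    define b where "b = v2 A3"
    have b: "A3 = cmul b Z" "b \<noteq> 0" using A3 n by (auto simp: b_def)
    let ?S = "span ({br U t |U t. t \<in> {Z, J Z}} \<union> {X})"
    have m: "A2 \<in> ?S" "A3 \<in> ?S" "A2 + 2 *\<^sub>R J A3 \<in> ?S"
      unfolding JYJZ[symmetric] by (auto simp: A2_def A3_def intro!: span_base)
    have "(1/2) *\<^sub>R ((A2 + 2 *\<^sub>R J A3) - A2) \<in> ?S" by (intro span_scale span_diff m)
    then have "J A3 \<in> ?S" by simp
    then have "cmul (inverse b) A3 \<in> ?S" "cmul (\<i> * inverse b) A3 \<in> ?S"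
      using m by (simp_all only: cmul_span_pair)
    then have "Z \<in> ?S" "J Z \<in> ?S"
      unfolding b(1) by (simp_all only: cmul_inverse[OF b(2)])
    then have "Z \<in> span {X}" using nilpotent_flag[of "{Z, J Z}" "{X}" Z] X by blast
    then show False using nspan[of Z] by (simp add: vs)
  qed
  define a where "a = Re (v3 A2)"
  have A2: "A2 = a *\<^sub>R X"
  proof -
    define c where "c = v2 A2"
    have A2': "A2 = cmul c Z + a *\<^sub>R X"
      using expand[of A2] Im(1) by (simp add: A2_def v1br cmul_def[of "v3 _"] a_def c_def)
    have "c = 0"
    proof (rule ccontr)
      assume c: "c \<noteq> 0"
      let ?S = "span ({br U t |U t. t \<in> {cmul c Z}} \<union> {X})"
      have "br Y (cmul c Z) \<in> ?S" "br (J Y) (cmul c Z) \<in> ?S" by (auto intro!: span_base)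
      then have "(1 / Re c) *\<^sub>R br Y (cmul c Z) \<in> ?S" "(1 / Im c) *\<^sub>R br (J Y) (cmul c Z) \<in> ?S"
        by (simp_all only: span_scale)
      moreover have br: "br Y (cmul c Z) = Re c *\<^sub>R A2" "br (J Y) (cmul c Z) = Im c *\<^sub>R A2"
        using JYZ JYJZ A30 by (simp_all add: cmul_def A2_def A3_def)
      moreover have "Re c \<noteq> 0 \<or> Im c \<noteq> 0" using c by (simp add: complex_eq_iff)
      ultimately have "A2 \<in> ?S" unfolding br by auto
      moreover have "X \<in> ?S" by (auto intro: span_base)
      ultimately have "A2 - a *\<^sub>R X \<in> ?S" by (intro span_diff span_scale)
      then have "cmul c Z \<in> ?S" using A2' by simp
      then have "cmul c Z \<in> span {X}" using nilpotent_flag[of "{cmul c Z}" "{X}" "cmul c Z"] X by blast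
      then show False using nspan[of "cmul c Z"] c by (simp add: vs v2s)
    qed
    then show ?thesis using A2' by simp
  qed
  have a0: "a \<noteq> 0"
  proof
    assume "a = 0"
    then have 0: "br Y Z = 0" "br Y (J Z) = 0" "br (J Y) Z = 0" "br (J Y) (J Z) = 0"
      using A2 A30 JYZ JYJZ by (simp_all add: A2_def A3_def)
    have "br U Z = 0 \<and> br U (J Z) = 0" for U
    proof -
      have U: "U = cmul (v1 U) Y + cmul (v2 U) Z + cmul (v3 U) X" by (rule dual_frame_expand[OF v])
      show ?thesis
        by (subst U, subst (2) U) (simp add: cmul_def 0 ZJZ Z br_swap[of "J Z" Z])
    qed
    then have "central Z" "central (J Z)" using br_swap[of Z] br_swap[of "J Z"] by (auto simp: central_def)
    then show False using noline Z0 by blast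
  qed
  show ?thesis
  proof (rule that[of X Z a Y "v2 (br Y (J Y))" "v3 (br Y (J Y))"])
    show "br Y (J Y) = cmul (v2 (br Y (J Y))) Z + cmul (v3 (br Y (J Y))) X" by (rule expand) (rule v1br)
    show "br Y (J Z) = 0" "br (J Y) Z = 0" "br Y Z = a *\<^sub>R X" "br (J Y) (J Z) = a *\<^sub>R X"
      using A2 A30 JYZ JYJZ by (simp_all add: A2_def A3_def)
  qed (use X Z Z0 ZJZ a0 in auto)
qed

end

section \<open>Hermitian metrics and closing forms\<close>

locale hermitian_nilpotent_lie_algebra = nilpotent_complex_lie_algebra br J
  for br :: "'a::real_vector \<Rightarrow> 'a \<Rightarrow> 'a" and J +
  fixes g :: "'a \<Rightarrow> 'a \<Rightarrow> real"
  assumes hermitian: "hermitian_metric J g"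
begin

abbreviation H :: "'a \<Rightarrow> 'a \<Rightarrow> 'a \<Rightarrow> real" where "H \<equiv> bismut_torsion br J g"

lemma bilinear_g: "bilinear g" using hermitian by (simp add: hermitian_metric_def)

lemma g_simps [simp]:
  "g (X + Y) Z = g X Z + g Y Z" "g X (Y + Z) = g X Y + g X Z"
  "g (X - Y) Z = g X Z - g Y Z" "g X (Y - Z) = g X Y - g X Z"
  "g (- X) Y = - g X Y" "g X (- Y) = - g X Y"
  "g 0 X = 0" "g X 0 = 0" "g (c *\<^sub>R X) Y = c * g X Y" "g X (c *\<^sub>R Y) = c * g X Y"
  using bilinear_g
  by (simp_all add: bilinear_ladd bilinear_radd bilinear_lsub bilinear_rsub bilinear_lneg bilinear_rneg
      bilinear_lzero bilinear_rzero bilinear_lmul bilinear_rmul)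

lemma g_sym: "g X Y = g Y X" using hermitian unfolding hermitian_metric_def by blast

lemma g_pos: "X \<noteq> 0 \<Longrightarrow> g X X > 0" using hermitian unfolding hermitian_metric_def by blast

lemma g_eq_0_iff: "g X X = 0 \<longleftrightarrow> X = 0" using g_pos[of X] by force

lemma g_nonneg: "g X X \<ge> 0" using g_pos[of X] by (cases "X = 0") auto

lemma g_J [simp]: "g (J X) Y = - g X (J Y)"
proof -
  have "g (J (J X)) (J Y) = g (J X) Y" using hermitian unfolding hermitian_metric_def by blast
  then show ?thesis by simp
qed

lemma g_self_J [simp]: "g X (J X) = 0"
  using g_J[of X X] g_sym[of X "J X"] by linarith

lemma H_eq: "H X Y Z = g (br (J X) (J Y)) Z + g (br (J Y) (J Z)) X + g (br (J Z) (J X)) Y"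
  unfolding bismut_torsion_def ce_d2_def fundamental_form_def
  by (subst br_swap[of "J Z" "J X"]) simp

lemma H_simps [simp]:
  "H (X + Y) U V = H X U V + H Y U V" "H U (X + Y) V = H U X V + H U Y V" "H U V (X + Y) = H U V X + H U V Y"
  "H (- X) U V = - H X U V" "H U (- X) V = - H U X V" "H U V (- X) = - H U V X"
  "H (c *\<^sub>R X) U V = c * H X U V" "H U (c *\<^sub>R X) V = c * H U X V" "H U V (c *\<^sub>R X) = c * H U V X"
  "H 0 U V = 0" "H U 0 V = 0" "H U V 0 = 0"
  by (simp_all add: H_eq algebra_simps)

lemma H_swap: "H X Y Z = - H Y X Z" "H X Y Z = - H X Z Y"
  using br_swap[of "J Y" "J X"] br_swap[of "J X" "J Z"] br_swap[of "J Z" "J Y"] by (simp_all add: H_eq)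

text \<open>For \<open>z\<close> and \<open>Jz\<close> central the form \<open>H(z, \<cdot>, \<cdot>)\<close> is the \<open>z\<close>-component of the bracket.  Inserting the
  bracket itself for \<open>z\<close> turns torsion terms into squared norms.\<close>

lemma H_central:
  assumes "central z" "central (J z)"
  shows "H z U V = g (br (J U) (J V)) z"
  by (simp add: H_eq centralD[OF assms(2)])

text \<open>The zero form is allowed, so that SKT structures are covered by the same lemmas.\<close>

definition closing_form :: "('a \<Rightarrow> real) \<Rightarrow> bool" where
  "closing_form \<alpha> \<longleftrightarrow> linear \<alpha> \<and> (\<forall>X Y. \<alpha> (br X Y) = 0) \<and>
     (\<forall>X Y Z W. ce_d3 br H X Y Z W = wedge13 \<alpha> H X Y Z W)"

lemma LCSKT_form_iff: "LCSKT_form br J g \<alpha> \<longleftrightarrow> closing_form \<alpha> \<and> \<alpha> \<noteq> (\<lambda>_. 0)"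
  by (auto simp: LCSKT_form_def closing_form_def ce_d1_def fun_eq_iff)

lemma SKT_iff: "SKT br J g \<longleftrightarrow> closing_form (\<lambda>_. 0)"
  using hermitian by (simp add: SKT_def closing_form_def fun_eq_iff wedge13_def linear_zero)

lemma LCSKT_iff: "LCSKT br J g \<longleftrightarrow> (\<exists>\<alpha>. closing_form \<alpha> \<and> \<alpha> \<noteq> (\<lambda>_. 0))"
  using hermitian by (auto simp: LCSKT_def LCSKT_form_iff)

lemma closing_formD:
  assumes "closing_form \<alpha>"
  shows "linear \<alpha>" "\<alpha> (br X Y) = 0" "ce_d3 br H X Y Z W = wedge13 \<alpha> H X Y Z W"
    "\<alpha> (X + Y) = \<alpha> X + \<alpha> Y" "\<alpha> (- X) = - \<alpha> X" "\<alpha> (c *\<^sub>R X) = c * \<alpha> X" "\<alpha> 0 = 0" "\<alpha> (X - Y) = \<alpha> X - \<alpha> Y"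
  using assms by (auto simp: closing_form_def linear_add linear_neg linear_scale linear_0 linear_diff)

text \<open>In the notation of lemma \<open>no_central_line_structure\<close>, closed forms vanish on \<open>X, Z, JZ\<close>.  The
  quadruple \<open>(X, JX, Y, JZ)\<close> gives \<open>\<alpha>(JX) = 0\<close>.  The quadruples \<open>(Y, JY, X, Z)\<close> and \<open>(Y, JY, X, JZ)\<close> give
  a linear system for \<open>\<alpha>(Y)\<close> and \<open>\<alpha>(JY)\<close> with determinant \<open>\<bar>Z\<bar>\<^sup>4 + a\<^sup>2 \<bar>X\<bar>\<^sup>4 > 0\<close>.  So \<open>\<alpha> \<and> H\<close> vanishes at
  \<open>(X, JX, Y, JY)\<close>, where \<open>dH\<close> is \<open>2 \<bar>Z\<bar>\<^sup>2\<close>.\<close>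

theorem no_closing_form_without_central_line:
  assumes noline: "\<And>X. central X \<Longrightarrow> central (J X) \<Longrightarrow> X = 0" and \<alpha>: "closing_form \<alpha>"
  shows False
proof -
  obtain X Y Z a k l where X: "central X" "X \<noteq> 0" "X \<in> derived" and Z0: "Z \<noteq> 0" and a: "a \<noteq> 0"
    and b: "br (J X) Y = Z" "br (J X) (J Y) = J Z" "br (J X) Z = 0" "br (J X) (J Z) = 0" "br Z (J Z) = 0"
      "br Y (J Z) = 0" "br (J Y) Z = 0" "br Y Z = a *\<^sub>R X" "br (J Y) (J Z) = a *\<^sub>R X"
    and K: "br Y (J Y) = cmul k Z + cmul l X"
    by (rule no_central_line_structure[OF noline])
  note \<alpha>s = closing_formD[OF \<alpha>]
  have "derived \<subseteq> {U. \<alpha> U = 0}"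
    by (rule derived_subset) (auto simp: \<alpha>s subspace_def)
  then have \<alpha>X: "\<alpha> X = 0" using X(3) by auto
  have \<alpha>Z: "\<alpha> Z = 0" "\<alpha> (J Z) = 0" using \<alpha>s(2)[of "J X" Y] \<alpha>s(2)[of "J X" "J Y"] b by simp_all
  have b': "br Y (J X) = - Z" "br (J Y) (J X) = - J Z" "br Z (J X) = 0" "br (J Z) (J X) = 0" "br (J Z) Z = 0"
    "br (J Z) Y = 0" "br Z (J Y) = 0" "br Z Y = - a *\<^sub>R X" "br (J Z) (J Y) = - a *\<^sub>R X"
    "br (J Y) Y = - cmul k Z - cmul l X"
    using b K br_swap[of Y "J X"] br_swap[of "J Y" "J X"] br_swap[of Z "J X"] br_swap[of "J Z" "J X"]
      br_swap[of "J Z" Z] br_swap[of "J Z" Y] br_swap[of Z "J Y"] br_swap[of Z Y] br_swap[of "J Z" "J Y"]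
      br_swap[of "J Y" Y] by simp_all
  note tab = b b' K centralD[OF X(1)] ce_d3_def wedge13_def H_eq \<alpha>s(4-8) \<alpha>X \<alpha>Z cmul_def
  have gs: "g Z X = g X Z" "g X (J Z) = - g Z (J X)" using g_sym[of Z X] g_sym[of X "J Z"] by simp_all
  have "\<alpha> (J X) * g Z Z = 0"
    using \<alpha>s(3)[of X "J X" Y "J Z"] by (simp add: tab gs)
  then have q: "\<alpha> (J X) = 0" using Z0 by (simp add: g_eq_0_iff)
  have 1: "\<alpha> Y * g Z Z + \<alpha> (J Y) * (a * g X X) = 0"
    using \<alpha>s(3)[of Y "J Y" X Z] by (simp add: tab gs q algebra_simps)
  have 2: "- \<alpha> Y * (a * g X X) + \<alpha> (J Y) * g Z Z = 0"
    using \<alpha>s(3)[of Y "J Y" X "J Z"] by (simp add: tab gs q algebra_simps)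
  have pos: "g Z Z > 0" using g_pos Z0 by simp
  have "(g Z Z)\<^sup>2 * \<alpha> Y + (a * g X X)\<^sup>2 * \<alpha> Y
      = g Z Z * (\<alpha> Y * g Z Z + \<alpha> (J Y) * (a * g X X)) - a * g X X * (- \<alpha> Y * (a * g X X) + \<alpha> (J Y) * g Z Z)"
    by algebra
  then have "((g Z Z)\<^sup>2 + (a * g X X)\<^sup>2) * \<alpha> Y = 0" unfolding 1 2 by (simp add: algebra_simps)
  moreover have "(g Z Z)\<^sup>2 + (a * g X X)\<^sup>2 > 0" using pos by (simp add: add_pos_nonneg)
  ultimately have \<alpha>Y: "\<alpha> Y = 0" by (metis less_irrefl mult_eq_0_iff)
  then have \<alpha>JY: "\<alpha> (J Y) = 0" using 2 pos \<alpha>Y by simp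
  have "g Z Z = 0"
    using \<alpha>s(3)[of X "J X" Y "J Y"] by (simp add: tab gs q \<alpha>Y \<alpha>JY)
  then show False using pos by simp
qed

end

context nilpotent_complex_lie_algebra
begin

section \<open>Recognising the two families\<close>

lemma wedge_conj: "wedge11 w (conj_form w) U V = - 2 * \<i> * of_real (Re (w U) * Im (w V) - Im (w U) * Re (w V))"
  by (simp add: wedge11_def conj_form_def complex_eq_iff algebra_simps)

text \<open>Modulo the central kernel of \<open>\<eta>\<close> the algebra is the plane \<open>\<langle>y, Jy\<rangle>\<close>, so the derived algebra is
  spanned by \<open>q = [y, Jy]\<close>.  The value \<open>2\<i>\<close> of \<open>- \<eta> \<and> cnj \<eta>\<close> at \<open>(y, Jy)\<close> requires \<open>q = 2 J e3\<close>.\<close>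

lemma equations_I_if_central_hyperplane:
  assumes \<eta>: "form_10 J \<eta>" "\<eta> y = 1" and closed: "\<And>U V. \<eta> (br U V) = 0"
    and central: "\<And>U V. \<eta> U = 0 \<Longrightarrow> br U V = 0" and ne: "br U0 V0 \<noteq> 0"
  obtains \<omega> where "basis_10 J 3 \<omega>" "equations_I br \<omega>"
proof -
  note \<eta>s = form_10_simps[OF \<eta>(1)]
  define q where "q = br y (J y)"
  have central': "\<eta> V = 0 \<Longrightarrow> br U V = 0" for U V using central[of V U] br_swap[of U V] by simp
  have br: "br U V = (Re (\<eta> U) * Im (\<eta> V) - Im (\<eta> U) * Re (\<eta> V)) *\<^sub>R q" for U V
  proof -
    define U' V' where "U' = U - cmul (\<eta> U) y" and "V' = V - cmul (\<eta> V) y"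
    have "\<eta> U' = 0" "\<eta> V' = 0" by (simp_all add: U'_def V'_def \<eta>s \<eta>(2))
    then have "br (U' + cmul (\<eta> U) y) (V' + cmul (\<eta> V) y) = br (cmul (\<eta> U) y) (cmul (\<eta> V) y)"
      by (simp add: central central')
    also have "\<dots> = (Re (\<eta> U) * Im (\<eta> V) - Im (\<eta> U) * Re (\<eta> V)) *\<^sub>R q"
      using br_swap[of "J y" y] by (simp add: cmul_def q_def algebra_simps)
    finally show ?thesis by (simp add: U'_def V'_def)
  qed
  define e3 where "e3 = (- 1 / 2) *\<^sub>R J q"
  have e3: "e3 \<noteq> 0"
  proof
    assume "e3 = 0"
    then have "J e3 = 0" by simp
    then have "q = 0" by (simp add: e3_def)
    then show False using ne br[of U0 V0] by simp
  qed
  have \<eta>e3: "\<eta> e3 = 0" by (simp add: e3_def \<eta>s q_def closed)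
  obtain e2 w2 w3 where f: "dual_frame \<eta> w2 w3 y e2 e3"
    using dual_frame_with_first_last[OF \<eta> \<eta>e3 e3] by blast
  note s = dual_frame_simps[OF f]
  have q: "q = 2 *\<^sub>R J e3" by (simp add: e3_def)
  define \<omega> where "\<omega> j = (if j = 1 then \<eta> else if j = 2 then w2 else w3)" for j :: nat
  have \<omega>: "\<omega> 1 = \<eta>" "\<omega> 2 = w2" "\<omega> 3 = w3" by (simp_all add: \<omega>_def)
  show ?thesis
  proof (rule that)
    show "basis_10 J 3 \<omega>" using dual_frame_basis_10[of \<omega>] f unfolding \<omega> by blast
    show "equations_I br \<omega>"
      unfolding equations_I_def \<omega> ce_d1_def
      by (intro conjI ext, unfold wedge_conj br)
        (simp_all add: \<eta>s q form_10_simps[OF s(2)] form_10_simps[OF s(3)] s mult.commute)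
  qed
qed

text \<open>Equations (II) in terms of the dual frame.\<close>

definition type_II_frame :: "'a \<Rightarrow> 'a \<Rightarrow> 'a \<Rightarrow> bool" where
  "type_II_frame e1 e2 e3 \<longleftrightarrow> central e2 \<and> central e3 \<and> central (J e3) \<and> br e1 (J e1) = 2 *\<^sub>R J e2 \<and>
     br e1 (J e2) = - 2 *\<^sub>R J e3 \<and> br (J e1) (J e2) = 2 *\<^sub>R e3"

lemma equations_II_iff_type_II_frame:
  assumes f: "dual_frame (\<omega> 1) (\<omega> 2) (\<omega> 3) e1 e2 e3"
  shows "equations_II br \<omega> \<longleftrightarrow> type_II_frame e1 e2 e3"
proof
  note s = dual_frame_simps[OF f]
  note ss = form_10_simps[OF s(1)] form_10_simps[OF s(2)] form_10_simps[OF s(3)] s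
  {
    assume II: "equations_II br \<omega>"
    have "\<omega> 1 (br U V) = 0" "wedge11 (\<omega> 1) (conj_form (\<omega> 1)) U V = - \<omega> 2 (br U V)"
      "wedge11 (\<omega> 1) (\<omega> 2) U V - wedge11 (\<omega> 1) (conj_form (\<omega> 2)) U V = - \<omega> 3 (br U V)" for U V
      using II by (simp_all add: equations_II_def ce_d1_def fun_eq_iff)
    then have d: "\<omega> 1 (br U V) = 0" "\<omega> 2 (br U V) = - wedge11 (\<omega> 1) (conj_form (\<omega> 1)) U V"
      "\<omega> 3 (br U V) = - (wedge11 (\<omega> 1) (\<omega> 2) U V - wedge11 (\<omega> 1) (conj_form (\<omega> 2)) U V)" for U V
      by simp_all
    show "type_II_frame e1 e2 e3"
      unfolding type_II_frame_def central_def
      by (intro conjI allI; rule dual_frame_eqI[OF f])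
         (simp_all add: d ss wedge11_def conj_form_def)
  next
    assume t: "type_II_frame e1 e2 e3"
    then have c: "central e3" "central (J e3)" "central e2" by (auto simp: type_II_frame_def)
    have z: "br e1 e2 = 0" "br (J e1) e2 = 0" "br e2 (J e2) = 0" using centralD[OF c(3)] by simp_all
    have b: "br e1 (J e1) = 2 *\<^sub>R J e2" "br e1 (J e2) = - 2 *\<^sub>R J e3" "br (J e1) (J e2) = 2 *\<^sub>R e3"
      using t by (auto simp: type_II_frame_def)
    have "\<omega> 1 (br U V) = 0" "\<omega> 2 (br U V) = - wedge11 (\<omega> 1) (conj_form (\<omega> 1)) U V"
      "\<omega> 3 (br U V) = - (wedge11 (\<omega> 1) (\<omega> 2) U V - wedge11 (\<omega> 1) (conj_form (\<omega> 2)) U V)" for U V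
      unfolding br_expand[OF f c(1,2), of U V] z b
      by (simp_all add: ss wedge11_def conj_form_def complex_eq_iff algebra_simps)
    then show "equations_II br \<omega>"
      by (simp add: equations_II_def ce_d1_def fun_eq_iff)
  }
qed

text \<open>The frame \<open>(Y, - J p / 2, C / 4)\<close> satisfies the bracket relations of family (II).\<close>

lemma equations_II_if:
  assumes a: "adapted_frame w1 w2 w3 Y p X" and p: "br Y (J Y) = p" and cp: "central (J p)"
    and C: "br Y p = - J C" "br (J Y) p = C" "C \<noteq> 0" "w2 C = 0"
  obtains \<omega> where "basis_10 J 3 \<omega>" "equations_II br \<omega>"
proof -
  have f: "dual_frame w1 w2 w3 Y p X" and c: "central X" "central (J X)"
    and w1br: "\<And>U V. w1 (br U V) = 0"
    using a by (auto simp: adapted_frame_def)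
  note s = dual_frame_simps[OF f]
  note ss = form_10_simps[OF s(1)] form_10_simps[OF s(2)] s
  define e2 e3 where "e2 = (- 1 / 2) *\<^sub>R J p" and "e3 = (1 / 4) *\<^sub>R C"
  have w1C: "w1 C = 0" using w1br C(2) by metis
  have e3: "e3 \<noteq> 0" "w1 e3 = 0" "w2 e3 = 0" using C w1C by (simp_all add: e3_def ss)
  have e2: "w1 e2 = 0" "w2 e2 \<noteq> 0" by (simp_all add: e2_def ss)
  have "e2 \<notin> span {e3, J e3}"
  proof
    assume "e2 \<in> span {e3, J e3}"
    then have "w2 e2 = 0" by (induction rule: span_induct_alt) (auto simp: ss e3)
    then show False using e2 by simp
  qed
  then obtain v2 v3 where v: "dual_frame w1 v2 v3 Y e2 e3"
    using dual_frame_with_first[OF s(1) s(4) e2(1) e3(2,1)] by blast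
  define \<omega> where "\<omega> j = (if j = 1 then w1 else if j = 2 then v2 else v3)" for j :: nat
  have \<omega>: "\<omega> 1 = w1" "\<omega> 2 = v2" "\<omega> 3 = v3" by (simp_all add: \<omega>_def)
  have ce3: "central e3" "central (J e3)" by (rule adapted_frame_central[OF a]; simp add: e3 ss)+
  have "central e2" using cp by (simp add: e2_def central_def)
  then have "type_II_frame Y e2 e3"
    unfolding type_II_frame_def using ce3 p C(1,2) by (simp add: e2_def e3_def)
  then have "equations_II br \<omega>" using equations_II_iff_type_II_frame[of \<omega>] v unfolding \<omega> by blast
  moreover have "basis_10 J 3 \<omega>" using dual_frame_basis_10[of \<omega>] v unfolding \<omega> by blast
  ultimately show ?thesis using that by blast
qed

text \<open>Since \<open>[P, \<gg>] \<subseteq> V\<close>, brackets outside \<open>V\<close> arise only from \<open>[Y, JY] = q\<close>, and \<open>q\<close> can replace \<open>p\<close> in the frame.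
  The Jacobi identity expresses \<open>[q, Jq]\<close> through brackets with elements of \<open>V\<close>.\<close>

lemma three_step_frame:
  assumes a: "adapted_frame w1 w2 w3 Y p X" and ne: "w2 (br U0 V0) \<noteq> 0"
  obtains v2 v3 q where "adapted_frame w1 v2 v3 Y q X" "br Y (J Y) = q" "br q (J q) = 0"
proof -
  have f: "dual_frame w1 w2 w3 Y p X" and c: "central X" "central (J X)"
    and w1br: "\<And>U V. w1 (br U V) = 0" and w2br: "\<And>U V. w1 U = 0 \<Longrightarrow> w2 (br U V) = 0"
    using a by (auto simp: adapted_frame_def)
  note s = dual_frame_simps[OF f]
  note ss = form_10_simps[OF s(1)] form_10_simps[OF s(2)] s
  define q where "q = br Y (J Y)"
  have w2br': "w2 (br V U) = 0" if "w1 U = 0" for U V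
    using w2br[OF that, of V] by (subst br_swap) (simp add: ss)
  have q: "w2 q \<noteq> 0"
  proof
    assume "w2 q = 0"
    then have "w2 (br U0 V0) = 0" unfolding br_expand[OF f c, of U0 V0] by (simp add: ss w2br w2br' q_def)
    then show False using ne by simp
  qed
  have "q \<notin> span {X, J X}" using q span_pair_mem_iff[OF f] by simp
  moreover have "X \<noteq> 0" using s(12) ss form_10_simps[OF s(3)] by force
  moreover have w1q: "w1 q = 0" by (simp add: q_def w1br)
  ultimately obtain v2 v3 where v: "dual_frame w1 v2 v3 Y q X"
    using dual_frame_with_first[OF s(1,4) _ s(6)] by blast
  have v2: "v2 U = 0" if "w1 U = 0" "w2 U = 0" for U
  proof -
    have "w2 U = w2 (cmul (w1 U) Y + cmul (v2 U) q + cmul (v3 U) X)" using dual_frame_expand[OF v, of U] by simp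
    then show ?thesis using that q by (simp add: ss)
  qed
  have av: "adapted_frame w1 v2 v3 Y q X"
    unfolding adapted_frame_def using v c w1br v2 w2br by blast
  have "central (br U (J q))" for U
    by (rule adapted_frame_central[OF a]) (simp_all add: w1br w2br' w1q ss)
  then have "br q (J q) = 0"
    unfolding q_def[symmetric] by (subst q_def) (use jacobi[of Y "J Y" "J q"] in \<open>simp add: centralD q_def\<close>)
  then show ?thesis using that av q_def by blast
qed

end

context hermitian_nilpotent_lie_algebra
begin

section \<open>Closing forms of nilpotent complex structures\<close>

text \<open>Evaluating at \<open>(X, JX, JU, JV)\<close>, where \<open>dH\<close> vanishes, shows that \<open>[U, V]\<close> is orthogonal to
  \<open>\<alpha>(X) JX - \<alpha>(JX) X\<close>.  A bracket in \<open>\<langle>X, JX\<rangle>\<close> is also in the kernel of \<open>\<alpha>\<close>, and these two conditions on a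
  plane have only the zero solution.\<close>

lemma bracket_zero_if_closing_form_not_vertical:
  assumes a: "adapted_frame w1 w2 w3 Y p X" and \<alpha>: "closing_form \<alpha>"
    and nz: "\<alpha> X \<noteq> 0 \<or> \<alpha> (J X) \<noteq> 0" and w2: "w2 (br U V) = 0"
  shows "br U V = 0"
proof -
  note F = adapted_frame_facts[OF a] and \<alpha>s = closing_formD[OF \<alpha>]
  have c': "central (J (J X))" using F(2) by (simp add: central_def)
  note cs = centralD[OF F(2)] centralD[OF F(3)]
  have "\<alpha> X * g (br U V) (J X) = \<alpha> (J X) * g (br U V) X"
    using \<alpha>s(3)[of X "J X" "J U" "J V"]
    by (simp add: ce_d3_def wedge13_def cs H_eq)
  moreover obtain a b where ab: "br U V = a *\<^sub>R X + b *\<^sub>R J X"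
    using dual_frame_expand[OF F(1), of "br U V"] F(4) w2 by (auto simp: cmul_def)
  ultimately have 1: "\<alpha> X * b * g X X = \<alpha> (J X) * a * g X X" using g_sym[of "J X" X] by simp
  have "X \<noteq> 0" using dual_frame_simps(12)[OF F(1)] form_10_simps(4)[OF dual_frame_simps(3)[OF F(1)]] by force
  with 1 have 2: "\<alpha> X * b = \<alpha> (J X) * a" by (simp add: g_eq_0_iff)
  have 3: "\<alpha> X * a + \<alpha> (J X) * b = 0" using \<alpha>s(2)[of U V] ab by (simp add: \<alpha>s(4-8) mult.commute)
  have "((\<alpha> X)\<^sup>2 + (\<alpha> (J X))\<^sup>2) * a = 0" "((\<alpha> X)\<^sup>2 + (\<alpha> (J X))\<^sup>2) * b = 0" using 2 3 by algebra+
  moreover have "(\<alpha> X)\<^sup>2 + (\<alpha> (J X))\<^sup>2 \<noteq> 0" using nz by (simp add: sum_power2_eq_zero_iff)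
  ultimately have "a = 0" "b = 0" by (metis mult_eq_0_iff)+
  then show ?thesis using ab by simp
qed

lemma dH_three_step:
  assumes a: "adapted_frame w1 w2 w3 Y p X" and p: "br Y (J Y) = p" "br p (J p) = 0"
  shows "ce_d3 br H Y (J Y) p (J p) = g (br Y p) (br Y p) + g (br Y (J p)) (br Y (J p))
     + g (br (J Y) p) (br (J Y) p) + g (br (J Y) (J p)) (br (J Y) (J p))"
proof -
  note F = adapted_frame_facts[OF a] note s = dual_frame_simps[OF F(1)]
  note ss = form_10_simps[OF s(1)] form_10_simps[OF s(2)] s
  have c: "central (br U V)" "central (J (br U V))" if "w1 V = 0" for U V
    by (rule adapted_frame_central[OF a]; simp add: F that ss)+
  have H1: "H (br U V) U' V' = g (br (J U') (J V')) (br U V)" if "w1 V = 0" for U V U' V'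
    using H_central c[OF that] by blast
  have "br (J p) p = 0" using br_swap[of "J p" p] p(2) by simp
  then have "H p p (J p) = 0" by (simp add: H_eq p(2))
  then show ?thesis
    using br_swap[of p "J Y"] br_swap[of p Y]
    by (simp add: ce_d3_def p H1 ss)
qed

text \<open>The sum of squares in lemma \<open>dH_three_step\<close> vanishes, so \<open>P\<close> is central.\<close>

lemma SKT_two_step:
  assumes skt: "closing_form (\<lambda>_. 0)"
  shows "br U (br V W) = 0"
proof -
  obtain X where X: "X \<noteq> 0" "central X" "central (J X)"
    using no_closing_form_without_central_line[OF _ skt] by blast
  obtain w1 w2 w3 Y p where a: "adapted_frame w1 w2 w3 Y p X" using adapted_frame_exists[OF X] by blast
  note F = adapted_frame_facts[OF a]
  show ?thesis
  proof (cases "\<exists>U V. w2 (br U V) \<noteq> 0")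
    case False
    then have "central (br V W)" using F(4) by (intro adapted_frame_central[OF a]) auto
    then show ?thesis by (rule centralD)
  next
    case True
    then obtain v2 v3 q where b: "adapted_frame w1 v2 v3 Y q X" "br Y (J Y) = q" "br q (J q) = 0"
      using three_step_frame[OF a] by blast
    note B = adapted_frame_facts[OF b(1)]
    have "0 = g (br Y q) (br Y q) + g (br Y (J q)) (br Y (J q))
       + g (br (J Y) q) (br (J Y) q) + g (br (J Y) (J q)) (br (J Y) (J q))"
      using closing_formD(3)[OF skt, of Y "J Y" q "J q"] dH_three_step[OF b] by (simp add: wedge13_def)
    then have z: "br Y q = 0" "br Y (J q) = 0" "br (J Y) q = 0" "br (J Y) (J q) = 0"
      using g_nonneg[of "br Y q"] g_nonneg[of "br Y (J q)"] g_nonneg[of "br (J Y) q"] g_nonneg[of "br (J Y) (J q)"]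
      by (simp_all add: g_eq_0_iff[symmetric])
    show ?thesis unfolding br_expand[OF B(1-3), of U "br V W"] by (simp add: B(4) z b(3))
  qed
qed

text \<open>Central \<open>P\<close> means family (I).  First, \<open>\<alpha>\<close> vanishes on \<open>V = \<langle>X, JX\<rangle>\<close>, as otherwise \<open>P = ker w1\<close> is
  central.  If all brackets lie in \<open>V\<close>, then \<open>\<alpha> - \<i> \<alpha> \<circ> J\<close> is a
  closed \<open>(1,0)\<close>-form, and quadruples with a bracket as one entry, followed by a sum of squares, show
  that its kernel, which replaces \<open>P\<close>, is central.
  Otherwise use the frame \<open>(Y, q, X)\<close> with \<open>q = [Y, JY]\<close>.  If \<open>\<alpha>(Jq) \<noteq> 0\<close>, then \<open>Jq\<close> is central and the
  remaining brackets are those of (II), or \<open>P\<close> is central.  If \<open>\<alpha>(Jq) = 0\<close>, then \<open>\<alpha> \<and> H\<close> vanishes at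
  \<open>(Y, JY, q, Jq)\<close>, and the sum of squares again makes \<open>P\<close> central.\<close>

theorem equations_I_or_II_if_closing_form:
  assumes \<alpha>: "closing_form \<alpha>" "\<alpha> \<noteq> (\<lambda>_. 0)" and ne: "br U0 V0 \<noteq> 0"
    and X: "X \<noteq> 0" "central X" "central (J X)"
  shows "\<exists>\<omega>. basis_10 J 3 \<omega> \<and> (equations_I br \<omega> \<or> equations_II br \<omega>)"
proof -
  note \<alpha>s = closing_formD[OF \<alpha>(1)]
  obtain w1 w2 w3 Y p where a: "adapted_frame w1 w2 w3 Y p X" using adapted_frame_exists[OF X] by blast
  note F = adapted_frame_facts[OF a] note s = dual_frame_simps[OF F(1)]
  note ss = form_10_simps[OF s(1)] form_10_simps[OF s(2)] s
  have type_I: ?thesis if "\<And>U V. w1 U = 0 \<Longrightarrow> br U V = 0"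
    using equations_I_if_central_hyperplane[OF s(1,4) F(4) that ne] by blast
  show ?thesis
  proof (cases "\<alpha> X = 0 \<and> \<alpha> (J X) = 0")
    case False
    then show ?thesis using type_I bracket_zero_if_closing_form_not_vertical[OF a \<alpha>(1)] F(5) by blast
  next
    case vertical: True
    have \<alpha>0: "\<alpha> Z = 0" "\<alpha> (J Z) = 0" if "w1 Z = 0" "w2 Z = 0" for Z
    proof -
      have "Z = cmul (w3 Z) X" using dual_frame_expand[OF F(1), of Z] that by simp
      then have "\<alpha> Z = \<alpha> (cmul (w3 Z) X)" "\<alpha> (J Z) = \<alpha> (J (cmul (w3 Z) X))" by simp_all
      then show "\<alpha> Z = 0" "\<alpha> (J Z) = 0" using vertical by (simp_all add: cmul_def \<alpha>s(4-8))
    qed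
    show ?thesis
    proof (cases "\<exists>U V. w2 (br U V) \<noteq> 0")
      case False
      then have w2: "w2 (br U V) = 0" for U V by blast
      have c: "central (br U V)" "central (J (br U V))" for U V
        by (rule adapted_frame_central[OF a]; simp add: F w2 ss)+
      have HC: "H (br U V) U' V' = g (br (J U') (J V')) (br U V)" for U V U' V' using H_central c by blast
      define \<eta> where "\<eta> U = complex_of_real (\<alpha> U) - \<i> * complex_of_real (\<alpha> (J U))" for U
      have \<eta>: "form_10 J \<eta>"
        unfolding form_10_def
        by (auto intro!: linearI simp: \<eta>_def \<alpha>s(4-8) algebra_simps scaleR_conv_of_real)
      note \<eta>s = form_10_simps[OF \<eta>]
      have \<eta>0: "\<eta> U = 0 \<longleftrightarrow> \<alpha> U = 0 \<and> \<alpha> (J U) = 0" for U by (auto simp: \<eta>_def complex_eq_iff)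
      have \<eta>br: "\<eta> (br U V) = 0" for U V using \<alpha>0[of "br U V"] F(4) w2 by (simp add: \<eta>0)
      obtain y0 where "\<alpha> y0 \<noteq> 0" using \<alpha>(2) by auto
      then have y0: "\<eta> y0 \<noteq> 0" by (auto simp: \<eta>_def complex_eq_iff)
      define y where "y = cmul (inverse (\<eta> y0)) y0"
      have \<eta>y: "\<eta> y = 1" using y0 by (simp add: y_def \<eta>s)
      then have \<alpha>y: "\<alpha> y = 1" "\<alpha> (J y) = 0" by (auto simp: \<eta>_def complex_eq_iff)
      \<comment> \<open>With the bracket \<open>?C\<close> as one entry, \<open>\<alpha> \<and> H\<close> at \<open>(y, ?C, u, v)\<close> is \<open>\<bar>?C\<bar>\<^sup>2\<close> and \<open>dH\<close> is zero.\<close>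
      have 1: "br (J u) (J v) = 0" if "\<alpha> u = 0" "\<alpha> v = 0" for u v
      proof -
        let ?C = "br (J u) (J v)"
        have "g ?C ?C = 0"
          using \<alpha>s(3)[of y ?C u v] \<alpha>0[OF F(4) w2] 
          by (simp add: ce_d3_def wedge13_def HC \<alpha>y that centralD[OF c(1)] centralD[OF c(2)])
        then show ?thesis by (simp add: g_eq_0_iff)
      qed
      have 2: "br u v = 0" if "\<eta> u = 0" "\<eta> v = 0" for u v
        using 1[of "- J u" "- J v"] that by (simp add: \<eta>0 \<alpha>s(4-8))
      have 3: "br y v = 0" "br v y = 0" if "\<eta> v = 0" for v
        using 1[of "- J y" "- J v"] 1[of "- J v" "- J y"] that by (simp_all add: \<eta>0 \<alpha>s(4-8) \<alpha>y)
      \<comment> \<open>Here \<open>\<alpha> \<and> H\<close> vanishes at \<open>(y, Jy, v, Jv)\<close> and \<open>dH\<close> is a sum of squares.\<close>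
      have 4: "br (J y) v = 0" if v: "\<eta> v = 0" for v
      proof -
        have Jv: "\<eta> (J v) = 0" by (simp add: \<eta>s v)
        have "g (br (J y) v) (br (J y) v) + g (br (J y) (J v)) (br (J y) (J v)) = 0"
          using \<alpha>s(3)[of y "J y" v "J v"] v Jv
          by (simp add: ce_d3_def wedge13_def HC 2 3 \<alpha>y)
             (simp add: \<eta>0 H_eq 2[OF v Jv] 2[OF Jv v] 3[OF v] 3[OF Jv] br_swap[of v "J y"])
        then show ?thesis using g_nonneg[of "br (J y) v"] g_nonneg[of "br (J y) (J v)"]
          by (simp add: g_eq_0_iff[symmetric])
      qed
      have 5: "br v V = 0" if v: "\<eta> v = 0" for v V
      proof -
        have "br v (V - cmul (\<eta> V) y) = 0" by (rule 2[OF v]) (simp only: \<eta>s \<eta>y, simp)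
        moreover have "br v (cmul (\<eta> V) y) = 0"
          using 3(2)[OF v] 4[OF v] br_swap[of v "J y"] by (simp add: cmul_def)
        ultimately show ?thesis by simp
      qed
      show ?thesis using equations_I_if_central_hyperplane[OF \<eta> \<eta>y \<eta>br 5 ne] by blast
    next
      case True
      then obtain v2 v3 q where b: "adapted_frame w1 v2 v3 Y q X" and q: "br Y (J Y) = q" "br q (J q) = 0"
        using three_step_frame[OF a] by blast
      note B = adapted_frame_facts[OF b] note t = dual_frame_simps[OF B(1)]
      note ts = form_10_simps[OF t(1)] form_10_simps[OF t(2)] t
      have \<alpha>q: "\<alpha> q = 0" using \<alpha>s(2)[of Y "J Y"] q by simp
      have q': "br (J q) q = 0" using br_swap[of "J q" q] q(2) by simp
      define A B' C D where "A = br Y q" and "B' = br Y (J q)" and "C = br (J Y) q" and "D = br (J Y) (J q)"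
      have br: "br q Y = - A" "br (J q) Y = - B'" "br q (J Y) = - C" "br (J q) (J Y) = - D" "br (J Y) Y = - q"
        using br_swap[of q Y] br_swap[of "J q" Y] br_swap[of q "J Y"] br_swap[of "J q" "J Y"] br_swap[of "J Y" Y] q
        by (simp_all add: A_def B'_def C_def D_def)
      have cent: "central Z" "central (J Z)" "\<alpha> Z = 0" if "Z \<in> {A, B', C, D}" for Z
      proof -
        have z: "w1 Z = 0" "v2 Z = 0" using that by (auto simp: A_def B'_def C_def D_def B ts)
        then show "central Z" "central (J Z)" using adapted_frame_central[OF b] by (simp_all add: ts)
        show "\<alpha> Z = 0" using that \<alpha>s(2) by (auto simp: A_def B'_def C_def D_def)
      qed
      note tab = ce_d3_def wedge13_def A_def[symmetric] B'_def[symmetric] C_def[symmetric] D_def[symmetric] br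
        q q' \<alpha>q H_eq centralD[OF cent(1)] centralD[OF cent(2)] cent(3)
      have Z1: "\<alpha> (J q) * g D Z = 0" "\<alpha> (J q) * g B' Z = 0"
        "\<alpha> Y * g B' Z + \<alpha> (J Y) * g D Z = 0"
        "\<alpha> Y * g A Z + \<alpha> (J Y) * g C Z + \<alpha> (J q) * g q Z = 0" if "Z \<in> {A, B', C, D}" for Z
        using \<alpha>s(3)[of Z Y q "J q"] \<alpha>s(3)[of Z "J Y" q "J q"] \<alpha>s(3)[of Z Y "J Y" q] \<alpha>s(3)[of Z Y "J Y" "J q"] that
        by (simp_all add: tab)
      show ?thesis
      proof (cases "\<alpha> (J q) = 0")
        case False
        then have BD: "B' = 0" "D = 0" using Z1(1)[of D] Z1(2)[of B'] by (simp_all add: g_eq_0_iff)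
        have JC: "A = - J C" using integrable[of Y q]
          by (simp add: A_def[symmetric] B'_def[symmetric] C_def[symmetric] D_def[symmetric] BD add_eq_0_iff)
        have cJq: "br (J q) V = 0" for V
          unfolding br_expand[OF B(1-3), of "J q" V] by (simp add: ts q B'_def[symmetric] D_def[symmetric] BD)
        show ?thesis
        proof (cases "C = 0")
          case True
          have "br U V = 0" if "w1 U = 0" for U V
            unfolding br_expand[OF B(1-3), of U V]
            by (simp add: that q tab(3-6) BD True JC)
          then show ?thesis by (rule type_I)
        next
          case False
          have "v2 C = 0" by (simp add: C_def B ts)
          moreover have "central (J q)" using cJq by (simp add: central_def)
          moreover have "br Y q = - J C" using JC A_def by metis
          moreover have "br (J Y) q = C" by (simp add: C_def)
          ultimately show ?thesis using equations_II_if[OF b q(1) _ _ _ False] by metis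
        qed
      next
        case True
        have zero: "\<alpha> Y * g B' (J q) + \<alpha> (J Y) * g D (J q) = 0" "\<alpha> Y * g A q + \<alpha> (J Y) * g C q = 0"
        proof -
          have "\<alpha> Y *\<^sub>R B' + \<alpha> (J Y) *\<^sub>R D = 0"
            using Z1(3)[of B'] Z1(3)[of D] g_eq_0_iff[of "\<alpha> Y *\<^sub>R B' + \<alpha> (J Y) *\<^sub>R D"]
            by (simp add: algebra_simps)
          then show "\<alpha> Y * g B' (J q) + \<alpha> (J Y) * g D (J q) = 0" by (metis g_simps(1,7,9))
          have "\<alpha> Y *\<^sub>R A + \<alpha> (J Y) *\<^sub>R C = 0"
            using Z1(4)[of A] Z1(4)[of C] True g_eq_0_iff[of "\<alpha> Y *\<^sub>R A + \<alpha> (J Y) *\<^sub>R C"]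
            by (simp add: algebra_simps)
          then show "\<alpha> Y * g A q + \<alpha> (J Y) * g C q = 0" by (metis g_simps(1,7,9))
        qed
        have "ce_d3 br H Y (J Y) q (J q) = \<alpha> Y * H (J Y) q (J q) - \<alpha> (J Y) * H Y q (J q)"
          using \<alpha>s(3)[of Y "J Y" q "J q"] by (simp add: wedge13_def \<alpha>q True)
        also have "\<dots> = - (\<alpha> Y * g B' (J q) + \<alpha> (J Y) * g D (J q)) - (\<alpha> Y * g A q + \<alpha> (J Y) * g C q)"
          by (simp add: tab algebra_simps)
        finally have "g A A + g B' B' + g C C + g D D = 0"
          using dH_three_step[OF b q] zero by (simp add: A_def B'_def C_def D_def)
        then have "A = 0" "B' = 0" "C = 0" "D = 0"
          using g_nonneg[of A] g_nonneg[of B'] g_nonneg[of C] g_nonneg[of D] by (simp_all add: g_eq_0_iff[symmetric])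
        then have "br U V = 0" if "w1 U = 0" for U V
          unfolding br_expand[OF B(1-3), of U V] by (simp add: that q tab(3-6))
        then show ?thesis by (rule type_I)
      qed
    qed
  qed
qed

end

section \<open>Alternating 4-forms\<close>

text \<open>Sorting the four indices with a five-comparator network reduces the claim to increasing
  quadruples of basis vectors; each comparator changes the value only by a sign.\<close>

lemma alternating4_vanishes:
  fixes \<Theta> :: "'a::real_vector \<Rightarrow> 'a \<Rightarrow> 'a \<Rightarrow> 'a \<Rightarrow> real" and e :: "nat \<Rightarrow> 'a"
  assumes lin: "\<And>b c d. linear (\<lambda>a. \<Theta> a b c d)"
    and s12: "\<And>a b c d. \<Theta> a b c d = - \<Theta> b a c d" and s23: "\<And>a b c d. \<Theta> a b c d = - \<Theta> a c b d"
    and s34: "\<And>a b c d. \<Theta> a b c d = - \<Theta> a b d c"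
    and span: "span (e ` {..<n}) = UNIV"
    and zero: "\<And>i j k l. i < j \<Longrightarrow> j < k \<Longrightarrow> k < l \<Longrightarrow> l < n \<Longrightarrow> \<Theta> (e i) (e j) (e k) (e l) = 0"
  shows "\<Theta> a b c d = 0"
proof -
  have s13: "\<Theta> a b c d = - \<Theta> c b a d" for a b c d
    using s12[of a b c d] s23[of b a c d] s12[of b c a d] by simp
  have s24: "\<Theta> a b c d = - \<Theta> a d c b" for a b c d
    using s23[of a b c d] s34[of a c b d] s23[of a c d b] by simp
  define Q where "Q i j k l \<longleftrightarrow> \<Theta> (e i) (e j) (e k) (e l) = 0" for i j k l
  have sorted: "Q i j k l" if le: "i \<le> j" "j \<le> k" "k \<le> l" "l < n" for i j k l
  proof (cases "i < j \<and> j < k \<and> k < l")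
    case True then show ?thesis using zero le(4) by (simp add: Q_def)
  next
    case False
    then consider "i = j" | "j = k" | "k = l" using le by linarith
    then show ?thesis
      by cases (use s12[of "e i" "e i"] s23[of "e i" "e j" "e j"] s34[of "e i" "e j" "e k" "e k"] in \<open>auto simp: Q_def\<close>)
  qed
  \<comment> \<open>The comparators of the network \<open>(1,2) (3,4) (1,3) (2,4) (2,3)\<close>, taken in reverse order.\<close>
  have n1: "Q i j k l" if "i \<le> j" "k \<le> l" "i \<le> k" "j \<le> l" "l < n" for i j k l
  proof (cases "j \<le> k")
    case True then show ?thesis using sorted that by blast
  next
    case False
    then have "Q i k j l" using sorted that by force
    then show ?thesis using s23[of "e i" "e j" "e k" "e l"] by (simp add: Q_def)
  qed
  have n2: "Q i j k l" if "i \<le> j" "k \<le> l" "i \<le> k" "j < n" "l < n" for i j k l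
  proof (cases "j \<le> l")
    case True then show ?thesis using n1 that by blast
  next
    case False
    then have "Q i l k j" using n1 that by force
    then show ?thesis using s24[of "e i" "e j" "e k" "e l"] by (simp add: Q_def)
  qed
  have n3: "Q i j k l" if "i \<le> j" "k \<le> l" "j < n" "l < n" for i j k l
  proof (cases "i \<le> k")
    case True then show ?thesis using n2 that by blast
  next
    case False
    then have "Q k l i j" using n2 that by force
    then show ?thesis
      using s13[of "e i" "e j" "e k" "e l"] s24[of "e k" "e j" "e i" "e l"] by (simp add: Q_def)
  qed
  have n4: "Q i j k l" if "i \<le> j" "j < n" "k < n" "l < n" for i j k l
    using n3[of i j k l] n3[of i j l k] that s34[of "e i" "e j" "e k" "e l"] by (cases "k \<le> l") (auto simp: Q_def)
  have all: "\<Theta> (e i) (e j) (e k) (e l) = 0" if "i < n" "j < n" "k < n" "l < n" for i j k l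
    using n4[of i j k l] n4[of j i k l] that s12[of "e i" "e j" "e k" "e l"] by (cases "i \<le> j") (auto simp: Q_def)
  have ext: "f x = 0" if "linear f" "\<And>i. i < n \<Longrightarrow> f (e i) = 0" for f :: "'a \<Rightarrow> real" and x
    using linear_eq_0_on_span[OF that(1), of "e ` {..<n}" x] that(2) span by auto
  have 1: "\<Theta> a (e j) (e k) (e l) = 0" if "j < n" "k < n" "l < n" for a j k l
    using ext[OF lin] all that by blast
  have 2: "\<Theta> a b (e k) (e l) = 0" if "k < n" "l < n" for a b k l
    using ext[OF lin, where x = b] 1 that s12 by (metis neg_equal_0_iff_equal)
  have 3: "\<Theta> a b c (e l) = 0" if "l < n" for a b c l
    using ext[OF lin, where x = c] 2 that s13 by (metis neg_equal_0_iff_equal)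
  have s14: "\<Theta> a b c d = - \<Theta> d b c a" for a b c d
    using s13[of a b c d] s34[of c b a d] s13[of c b d a] by simp
  show ?thesis
    using ext[OF lin, where x = d] 3 s14 by (metis neg_equal_0_iff_equal)
qed

context hermitian_nilpotent_lie_algebra
begin

section \<open>The two families\<close>

text \<open>The bracket is \<open>[U, V] = \<beta>(U, V) q\<close> with \<open>q\<close> central and \<open>\<beta> = Re \<omega>\<^sub>1 \<and> Im \<omega>\<^sub>1\<close>, and \<open>\<beta>\<close> is \<open>J\<close>-invariant, so
  \<open>H = \<beta> \<and> g(q, \<cdot>)\<close> and \<open>dH\<close> is a multiple of \<open>\<beta> \<and> \<beta> = 0\<close>.  Conversely, for \<open>p\<close> in the kernel of \<open>\<omega>\<^sub>1\<close> the
  quadruple \<open>(q, e1, Je1, p)\<close> gives \<open>\<alpha>(p) = 0\<close>.\<close>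

lemma closing_form_I_iff:
  assumes f: "dual_frame (\<omega> 1) (\<omega> 2) (\<omega> 3) e1 e2 e3" and I: "equations_I br \<omega>"
  shows "closing_form \<alpha> \<longleftrightarrow> (\<exists>l. \<forall>X. \<alpha> X = 2 * Re (l * \<omega> 1 X))"
proof -
  note s = dual_frame_simps[OF f]
  note ss = form_10_simps[OF s(1)] form_10_simps[OF s(2)] form_10_simps[OF s(3)] s
  define q where "q = 2 *\<^sub>R J e3"
  define \<beta> where "\<beta> U V = Re (\<omega> 1 U) * Im (\<omega> 1 V) - Im (\<omega> 1 U) * Re (\<omega> 1 V)" for U V
  have w: "\<omega> 1 (br U V) = 0" "\<omega> 2 (br U V) = 0" "wedge11 (\<omega> 1) (conj_form (\<omega> 1)) U V = - \<omega> 3 (br U V)" for U V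
    using I by (simp_all add: equations_I_def ce_d1_def fun_eq_iff)
  have w3: "\<omega> 3 (br U V) = 2 * \<i> * of_real (\<beta> U V)" for U V
    using w(3)[of U V] by (simp add: wedge_conj \<beta>_def)
  have br: "br U V = \<beta> U V *\<^sub>R q" for U V
    by (rule dual_frame_eqI[OF f]) (simp_all add: w w3 q_def ss)
  have \<omega>q: "\<omega> 1 q = 0" by (simp add: q_def ss)
  have q: "br e1 (J e1) = q" "br q U = 0" "br U q = 0" "br (J q) U = 0" "br U (J q) = 0" "q \<noteq> 0" for U
  proof -
    have "\<omega> 3 q \<noteq> 0" by (simp add: q_def ss)
    then show "q \<noteq> 0" by (auto simp: ss)
  qed (simp_all add: br \<beta>_def ss \<omega>q)
  have HJ: "H U V W = \<beta> U V * g q W + \<beta> V W * g q U + \<beta> W U * g q V" for U V W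
    by (simp add: H_eq br \<beta>_def ss)
  have \<beta>q: "\<beta> q U = 0" "\<beta> U q = 0" for U by (simp_all add: \<beta>_def \<omega>q)
  show ?thesis
  proof
    assume \<alpha>: "closing_form \<alpha>"
    note \<alpha>s = closing_formD[OF \<alpha>]
    have \<alpha>q: "\<alpha> q = 0" using \<alpha>s(2)[of e1 "J e1"] q(1) by simp
    have \<alpha>p: "\<alpha> p = 0" if p: "\<omega> 1 p = 0" for p
    proof -
      have "\<alpha> p * g q q = 0"
        using \<alpha>s(3)[of q e1 "J e1" p]
        by (simp add: ce_d3_def wedge13_def HJ q \<alpha>q \<beta>q) (simp add: \<beta>_def p ss w)
      then show ?thesis using q(6) by (simp add: g_eq_0_iff)
    qed
    have "\<alpha> X = 2 * Re (Complex (\<alpha> e1 / 2) (- \<alpha> (J e1) / 2) * \<omega> 1 X)" for X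
    proof -
      have "\<alpha> (X - cmul (\<omega> 1 X) e1) = 0" by (rule \<alpha>p) (simp add: ss)
      then show ?thesis by (simp add: cmul_def \<alpha>s(4-8))
    qed
    then show "\<exists>l. \<forall>X. \<alpha> X = 2 * Re (l * \<omega> 1 X)" by blast
  next
    assume "\<exists>l. \<forall>X. \<alpha> X = 2 * Re (l * \<omega> 1 X)"
    then obtain l where l: "\<And>X. \<alpha> X = 2 * Re (l * \<omega> 1 X)" by blast
    have Hq: "H q U V = \<beta> U V * g q q" for U V by (simp add: HJ \<beta>q)
    have "ce_d3 br H X Y Z W = wedge13 \<alpha> H X Y Z W" for X Y Z W
      unfolding ce_d3_def wedge13_def br[of X Y] br[of X Z] br[of X W] br[of Y Z] br[of Y W] br[of Z W] H_simps Hq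
      unfolding HJ l \<beta>_def by (simp add: algebra_simps)
    then show "closing_form \<alpha>"
      unfolding closing_form_def l by (auto intro!: linearI simp: w l ss algebra_simps)
  qed
qed

lemma type_II_brackets:
  assumes f: "dual_frame w1 w2 w3 e1 e2 e3" and t: "type_II_frame e1 e2 e3"
  shows "br e1 (J e1) = 2 *\<^sub>R J e2" "br (J e1) e1 = - 2 *\<^sub>R J e2" "br e1 (J e2) = - 2 *\<^sub>R J e3"
    "br (J e2) e1 = 2 *\<^sub>R J e3" "br (J e1) (J e2) = 2 *\<^sub>R e3" "br (J e2) (J e1) = - 2 *\<^sub>R e3"
    "br e2 U = 0" "br U e2 = 0" "br e3 U = 0" "br U e3 = 0" "br (J e3) U = 0" "br U (J e3) = 0"
  using t centralD br_swap[of "J e1" e1] br_swap[of "J e2" e1] br_swap[of "J e2" "J e1"]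
  by (auto simp: type_II_frame_def)

text \<open>The second quantity is, up to the factor \<open>g(e3, e3)\<close>, the squared norm of the component of
  \<open>g(e3, e3) e2\<close> orthogonal to the complex line of \<open>e3\<close>.\<close>

lemma gram_determinant_pos:
  assumes f: "dual_frame w1 w2 w3 e1 e2 e3"
  shows "g e3 e3 > 0" "g e2 e2 * g e3 e3 - (g e2 e3)\<^sup>2 - (g e2 (J e3))\<^sup>2 > 0"
proof -
  note s = dual_frame_simps[OF f]
  have "e3 \<noteq> 0" using s(12) form_10_simps(4)[OF s(3)] by force
  then show pos: "g e3 e3 > 0" by (rule g_pos)
  define u where "u = g e3 e3 *\<^sub>R e2 - g e2 e3 *\<^sub>R e3 - g e2 (J e3) *\<^sub>R J e3"
  have "w2 u = of_real (g e3 e3)" by (simp add: u_def form_10_simps[OF s(2)] s)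
  then have "u \<noteq> 0" using pos form_10_simps(4)[OF s(2)] by force
  then have "g u u > 0" by (rule g_pos)
  moreover have "g u u = g e3 e3 * (g e2 e2 * g e3 e3 - (g e2 e3)\<^sup>2 - (g e2 (J e3))\<^sup>2)"
    using g_sym[of e3 e2] g_sym[of e3 "J e2"] by (simp add: u_def algebra_simps power2_eq_square)
  ultimately show "g e2 e2 * g e3 e3 - (g e2 e3)\<^sup>2 - (g e2 (J e3))\<^sup>2 > 0"
    using pos by (simp add: zero_less_mult_iff)
qed

text \<open>The three values \<open>0\<close> express closedness, because \<open>Je2, e3, Je3\<close> span the derived algebra.  Of the
  fifteen quadruples of basis vectors only \<open>(e1, Je1, e2, e3)\<close>, \<open>(e1, Je1, e2, Je3)\<close> and
  \<open>(e1, Je1, e2, Je2)\<close> give conditions beyond these; they are the three equations.\<close>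

lemma closing_form_II_linear_system:
  assumes f: "dual_frame w1 w2 w3 e1 e2 e3" and t: "type_II_frame e1 e2 e3"
  shows "closing_form \<alpha> \<longleftrightarrow> linear \<alpha> \<and> \<alpha> (J e2) = 0 \<and> \<alpha> e3 = 0 \<and> \<alpha> (J e3) = 0 \<and>
      \<alpha> e1 * g e3 e3 = - \<alpha> e2 * g e2 e3 \<and> \<alpha> (J e1) * g e3 e3 = - \<alpha> e2 * g e2 (J e3) \<and>
      4 * g e3 e3 = \<alpha> e2 * g e2 e2 + \<alpha> e1 * g e2 e3 + \<alpha> (J e1) * g e2 (J e3)"
proof -
  note tab = type_II_brackets[OF f t] ce_d3_def wedge13_def H_eq
  have gs: "g e2 e1 = g e1 e2" "g e3 e1 = g e1 e3" "g e3 e2 = g e2 e3"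
    "g e2 (J e1) = - g e1 (J e2)" "g e3 (J e1) = - g e1 (J e3)" "g e3 (J e2) = - g e2 (J e3)"
    using g_sym[of e2 e1] g_sym[of e3 e1] g_sym[of e3 e2] g_sym[of e2 "J e1"] g_sym[of e3 "J e1"] g_sym[of e3 "J e2"]
    by simp_all
  show ?thesis
  proof
    assume \<alpha>: "closing_form \<alpha>"
    note \<alpha>s = closing_formD[OF \<alpha>]
    have 0: "\<alpha> (J e2) = 0" "\<alpha> e3 = 0" "\<alpha> (J e3) = 0"
      using \<alpha>s(2)[of e1 "J e1"] \<alpha>s(2)[of "J e1" "J e2"] \<alpha>s(2)[of e1 "J e2"]
      by (simp_all add: type_II_brackets[OF f t] \<alpha>s(4-8))
    show "linear \<alpha> \<and> \<alpha> (J e2) = 0 \<and> \<alpha> e3 = 0 \<and> \<alpha> (J e3) = 0 \<and>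
      \<alpha> e1 * g e3 e3 = - \<alpha> e2 * g e2 e3 \<and> \<alpha> (J e1) * g e3 e3 = - \<alpha> e2 * g e2 (J e3) \<and>
      4 * g e3 e3 = \<alpha> e2 * g e2 e2 + \<alpha> e1 * g e2 e3 + \<alpha> (J e1) * g e2 (J e3)"
      using \<alpha>s(3)[of e3 e1 "J e1" e2] \<alpha>s(3)[of "J e3" e1 "J e1" e2] \<alpha>s(3)[of e1 "J e1" e2 "J e2"]
      by (simp add: tab gs 0 \<alpha>s(1,4-8) algebra_simps)
  next
    assume "linear \<alpha> \<and> \<alpha> (J e2) = 0 \<and> \<alpha> e3 = 0 \<and> \<alpha> (J e3) = 0 \<and>
      \<alpha> e1 * g e3 e3 = - \<alpha> e2 * g e2 e3 \<and> \<alpha> (J e1) * g e3 e3 = - \<alpha> e2 * g e2 (J e3) \<and>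
      4 * g e3 e3 = \<alpha> e2 * g e2 e2 + \<alpha> e1 * g e2 e3 + \<alpha> (J e1) * g e2 (J e3)"
    then have lin: "linear \<alpha>" and 0: "\<alpha> (J e2) = 0" "\<alpha> e3 = 0" "\<alpha> (J e3) = 0" and
      E: "\<alpha> e1 * g e3 e3 = - \<alpha> e2 * g e2 e3" "\<alpha> (J e1) * g e3 e3 = - \<alpha> e2 * g e2 (J e3)"
      "4 * g e3 e3 = \<alpha> e2 * g e2 e2 + \<alpha> e1 * g e2 e3 + \<alpha> (J e1) * g e2 (J e3)" by blast+
    note l = linear_add[OF lin] linear_diff[OF lin] linear_scale[OF lin] linear_0[OF lin] linear_neg[OF lin]
    define \<Theta> where "\<Theta> X Y Z W = ce_d3 br H X Y Z W - wedge13 \<alpha> H X Y Z W" for X Y Z W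
    define e where "e i = [e1, J e1, e2, J e2, e3, J e3] ! i" for i
    have "\<Theta> X Y Z W = 0" for X Y Z W
    proof (rule alternating4_vanishes[where \<Theta> = \<Theta> and e = e and n = 6])
      show "linear (\<lambda>a. \<Theta> a b c d)" for b c d
        by (rule linearI) (simp_all add: \<Theta>_def ce_d3_def wedge13_def l algebra_simps)
      show "\<Theta> X Y Z W = - \<Theta> Y X Z W" for X Y Z W
        using br_swap[of Y X] H_swap(2)[of "br Z W" Y X] H_swap(1)[of Y X W] H_swap(1)[of Y X Z]
        by (simp add: \<Theta>_def ce_d3_def wedge13_def)
      show "\<Theta> X Y Z W = - \<Theta> X Z Y W" for X Y Z W
        using br_swap[of Z Y] H_swap(2)[of "br X W" Z Y] H_swap(1)[of Z Y W] H_swap(2)[of X Z Y]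
        by (simp add: \<Theta>_def ce_d3_def wedge13_def)
      show "\<Theta> X Y Z W = - \<Theta> X Y W Z" for X Y Z W
        using br_swap[of W Z] H_swap(2)[of "br X Y" W Z] H_swap(2)[of Y W Z] H_swap(2)[of X W Z]
        by (simp add: \<Theta>_def ce_d3_def wedge13_def)
      have "{..<6} = {0, 1, 2, 3, 4, 5 :: nat}" by auto
      then have "e ` {..<6} = {e1, J e1, e2, J e2, e3, J e3}" by (simp add: e_def)
      then show "span (e ` {..<6}) = UNIV" using dual_frame_span[OF f] by simp
      show "\<Theta> (e i) (e j) (e k) (e m) = 0" if "i < j" "j < k" "k < m" "m < 6" for i j k m
      proof -
        have "(i, j, k, m) \<in> {(0,1,2,3), (0,1,2,4), (0,1,2,5), (0,1,3,4), (0,1,3,5), (0,1,4,5), (0,2,3,4), (0,2,3,5),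
           (0,2,4,5), (0,3,4,5), (1,2,3,4), (1,2,3,5), (1,2,4,5), (1,3,4,5), (2,3,4,5)}"
          using that by simp presburger
        moreover have e: "e 0 = e1" "e 1 = J e1" "e 2 = e2" "e 3 = J e2" "e 4 = e3" "e 5 = J e3"
          by (simp_all add: e_def)
        ultimately show ?thesis
          using E by (auto simp: e \<Theta>_def tab gs 0 l algebra_simps)
      qed
    qed
    moreover have "\<alpha> (br U V) = 0" for U V
    proof -
      have "central e3" "central (J e3)" using t by (auto simp: type_II_frame_def)
      then show ?thesis
        by (subst br_expand[OF f, of U V]) (simp_all add: type_II_brackets[OF f t] l 0)
    qed
    ultimately show "closing_form \<alpha>" using lin by (simp add: closing_form_def \<Theta>_def)
  qed
qed

lemma closing_form_II_iff:
  assumes f: "dual_frame w1 w2 w3 e1 e2 e3" and t: "type_II_frame e1 e2 e3"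
  defines "N \<equiv> g e3 e3" and "\<Delta> \<equiv> g e2 e2 * g e3 e3 - (g e2 e3)\<^sup>2 - (g e2 (J e3))\<^sup>2"
  shows "closing_form \<alpha> \<longleftrightarrow>
    (\<forall>X. \<alpha> X = 4 * N / \<Delta> * (N * Re (w2 X) - g e2 e3 * Re (w1 X) - g e2 (J e3) * Im (w1 X)))"
proof -
  note s = dual_frame_simps[OF f]
  note ss = form_10_simps[OF s(1)] form_10_simps[OF s(2)] form_10_simps[OF s(3)] s
  have pos: "N > 0" "\<Delta> > 0" using gram_determinant_pos[OF f] by (simp_all add: N_def \<Delta>_def)
  show ?thesis
  proof
    assume "closing_form \<alpha>"
    then have lin: "linear \<alpha>" and 0: "\<alpha> (J e2) = 0" "\<alpha> e3 = 0" "\<alpha> (J e3) = 0" and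
      E: "\<alpha> e1 * N = - \<alpha> e2 * g e2 e3" "\<alpha> (J e1) * N = - \<alpha> e2 * g e2 (J e3)"
      "4 * N = \<alpha> e2 * g e2 e2 + \<alpha> e1 * g e2 e3 + \<alpha> (J e1) * g e2 (J e3)"
      unfolding closing_form_II_linear_system[OF f t] N_def by blast+
    have "4 * N * N = \<alpha> e2 * g e2 e2 * N + (\<alpha> e1 * N) * g e2 e3 + (\<alpha> (J e1) * N) * g e2 (J e3)"
      using E(3) by algebra
    also have "\<dots> = \<alpha> e2 * \<Delta>" unfolding E(1,2) by (simp add: \<Delta>_def N_def power2_eq_square algebra_simps)
    finally have a2: "\<alpha> e2 = 4 * N * N / \<Delta>" using pos by (simp add: field_simps)
    have "\<alpha> e1 = - \<alpha> e2 * g e2 e3 / N" "\<alpha> (J e1) = - \<alpha> e2 * g e2 (J e3) / N"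
      using E(1,2) pos by (simp_all add: field_simps)
    then have a1: "\<alpha> e1 = - 4 * N / \<Delta> * g e2 e3" "\<alpha> (J e1) = - 4 * N / \<Delta> * g e2 (J e3)"
      unfolding a2 using pos by (simp_all add: field_simps)
    show "\<forall>X. \<alpha> X = 4 * N / \<Delta> * (N * Re (w2 X) - g e2 e3 * Re (w1 X) - g e2 (J e3) * Im (w1 X))"
    proof
      fix X
      have "\<alpha> X = \<alpha> (cmul (w1 X) e1 + cmul (w2 X) e2 + cmul (w3 X) e3)" using dual_frame_expand[OF f, of X] by simp
      also have "\<dots> = Re (w1 X) * \<alpha> e1 + Im (w1 X) * \<alpha> (J e1) + Re (w2 X) * \<alpha> e2"
        by (simp add: cmul_def linear_add[OF lin] linear_scale[OF lin] 0)
      also have "\<dots> = 4 * N / \<Delta> * (N * Re (w2 X) - g e2 e3 * Re (w1 X) - g e2 (J e3) * Im (w1 X))"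
        unfolding a1 a2 using pos by (simp add: field_simps)
      finally show "\<alpha> X = 4 * N / \<Delta> * (N * Re (w2 X) - g e2 e3 * Re (w1 X) - g e2 (J e3) * Im (w1 X))" .
    qed
  next
    assume *: "\<forall>X. \<alpha> X = 4 * N / \<Delta> * (N * Re (w2 X) - g e2 e3 * Re (w1 X) - g e2 (J e3) * Im (w1 X))"
    have "linear \<alpha>" by (rule linearI) (simp_all add: * ss algebra_simps add_divide_distrib diff_divide_distrib)
    moreover have v: "\<alpha> (J e2) = 0" "\<alpha> e3 = 0" "\<alpha> (J e3) = 0" "\<alpha> e2 = 4 * N / \<Delta> * N"
      "\<alpha> e1 = - (4 * N / \<Delta> * g e2 e3)" "\<alpha> (J e1) = - (4 * N / \<Delta> * g e2 (J e3))"
      unfolding *[rule_format] by (simp_all add: ss)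
    moreover have "\<alpha> e2 * g e2 e2 + \<alpha> e1 * g e2 e3 + \<alpha> (J e1) * g e2 (J e3) = 4 * N / \<Delta> * \<Delta>"
      unfolding v by (subst (5) \<Delta>_def) (simp add: N_def algebra_simps power2_eq_square)
    ultimately show "closing_form \<alpha>"
      unfolding closing_form_II_linear_system[OF f t] using pos by (simp add: N_def)
  qed
qed

lemma dH_II_nonzero:
  assumes f: "dual_frame w1 w2 w3 e1 e2 e3" and t: "type_II_frame e1 e2 e3"
  shows "ce_d3 br H \<noteq> (\<lambda>_ _ _ _. 0)"
proof
  assume "ce_d3 br H = (\<lambda>_ _ _ _. 0)"
  then have "ce_d3 br H e1 (J e1) e2 (J e2) = 0" by simp
  then have "g e3 e3 = 0" by (simp add: ce_d3_def H_eq type_II_brackets[OF f t])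
  then show False using gram_determinant_pos(1)[OF f] by simp
qed

text \<open>The parameters are Gram matrix entries: \<open>g(e2, e2) = 2s\<close>, \<open>g(e3, e3) = 2t\<close>, \<open>g(e2, e3) = 2 Im v\<close> and
  \<open>g(e2, Je3) = - 2 Re v\<close>.  In particular \<open>\<alpha>\<close> depends only on \<open>s\<close>, \<open>t\<close> and \<open>v\<close>.\<close>

lemma closing_form_II_parameters:
  assumes f: "dual_frame (\<omega> 1) (\<omega> 2) (\<omega> 3) e1 e2 e3" and t: "type_II_frame e1 e2 e3"
    and p: "form_parameters \<omega> (fundamental_form J g) r s t u v z"
  shows "closing_form \<alpha> \<longleftrightarrow>
     (\<forall>X. complex_of_real (\<alpha> X) =
                    - (2 * \<i> * t * cnj v / (t * s - (cmod v)\<^sup>2) * \<omega> 1 X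
                       - 2 * \<i> * t * v / (t * s - (cmod v)\<^sup>2) * cnj (\<omega> 1 X)
                       - 4 * t\<^sup>2 / (t * s - (cmod v)\<^sup>2) * Re (\<omega> 2 X)))"
proof -
  note d = dual_frame_simps[OF f]
  note ds = form_10_simps[OF d(1)] form_10_simps[OF d(2)] form_10_simps[OF d(3)] d
  have \<Omega>: "complex_of_real (g X (J Y)) = - (let W = (\<lambda>j k. wedge11 (\<omega> j) (conj_form (\<omega> k)) X Y) in
          \<i> * (complex_of_real r * W 1 1 + complex_of_real s * W 2 2 + complex_of_real t * W 3 3)
          + u * W 1 2 - cnj u * W 2 1 + v * W 2 3 - cnj v * W 3 2 + z * W 1 3 - cnj z * W 3 1)" for X Y
    using p g_J[of X Y] unfolding form_parameters_def fundamental_form_def Let_def by (metis minus_minus of_real_minus)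
  have pos: "t > 0" "t * s - (cmod v)\<^sup>2 > 0" using p by (simp_all add: form_parameters_def mult.commute)
  have "complex_of_real (g e3 e3) = complex_of_real (2 * t)" "complex_of_real (g e2 e2) = complex_of_real (2 * s)"
    "complex_of_real (g e2 e3) = complex_of_real (2 * Im v)" "complex_of_real (g e2 (J e3)) = complex_of_real (- 2 * Re v)"
    using \<Omega>[of e3 "- J e3"] \<Omega>[of e2 "- J e2"] \<Omega>[of e2 "- J e3"] \<Omega>[of e2 e3]
    by (simp_all add: ds wedge11_def conj_form_def complex_eq_iff)
  then have gv: "g e3 e3 = 2 * t" "g e2 e2 = 2 * s" "g e2 e3 = 2 * Im v" "g e2 (J e3) = - 2 * Re v"
    by (simp_all only: of_real_eq_iff)
  define D where "D = t * s - (cmod v)\<^sup>2"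
  have Dpos: "D > 0" using pos(2) by (simp add: D_def)
  have D: "g e2 e2 * g e3 e3 - (g e2 e3)\<^sup>2 - (g e2 (J e3))\<^sup>2 = 4 * D"
    unfolding gv D_def cmod_power2 by (simp add: power2_eq_square)
  have "(complex_of_real a = - (2 * \<i> * t * cnj v / D * w - 2 * \<i> * t * v / D * cnj w - 4 * t\<^sup>2 / D * Re w'))
     \<longleftrightarrow> a = 4 * (2 * t) / (4 * D) * (2 * t * Re w' - 2 * Im v * Re w - - 2 * Re v * Im w)" for a w w'
  proof -
    have "- (2 * \<i> * t * cnj v / D * w - 2 * \<i> * t * v / D * cnj w - 4 * t\<^sup>2 / D * Re w')
      = complex_of_real (4 * (2 * t) / (4 * D) * (2 * t * Re w' - 2 * Im v * Re w - - 2 * Re v * Im w))"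
      using Dpos by (simp add: complex_eq_iff field_simps power2_eq_square)
    then show ?thesis by (simp only: of_real_eq_iff)
  qed
  then show ?thesis
    unfolding closing_form_II_iff[OF f t] D unfolding gv D_def by simp
qed

end

section \<open>The classification\<close>

context nilpotent_complex_lie_algebra
begin

lemma hermitian_locale:
  "hermitian_metric J g \<Longrightarrow> hermitian_nilpotent_lie_algebra br J g"
  by (simp add: hermitian_nilpotent_lie_algebra_def hermitian_nilpotent_lie_algebra_axioms_def
      nilpotent_complex_lie_algebra_axioms)

lemma not_LCSKT_if_not_nilpotent:
  assumes "\<not> nilpotent_complex_structure br J"
  shows "\<not> admits_LCSKT br J"
proof
  assume "admits_LCSKT br J"
  then obtain g where g: "LCSKT br J g" by (auto simp: admits_LCSKT_def)
  then interpret hermitian_nilpotent_lie_algebra br J g by (intro hermitian_locale) (simp add: LCSKT_def)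
  obtain \<alpha> where \<alpha>: "closing_form \<alpha>" using g by (auto simp: LCSKT_iff)
  obtain X where X: "X \<noteq> 0" "central X" "central (J X)"
    using no_closing_form_without_central_line[OF _ \<alpha>] by blast
  show False using adapted_frame_exists[OF X] nilpotent_if_adapted_frame assms by metis
qed

lemma equations_if_admits_LCSKT:
  assumes nil: "nilpotent_complex_structure br J" and nb: "\<not> bi_invariant br J" and ad: "admits_LCSKT br J"
  shows "\<exists>\<omega>. basis_10 J 3 \<omega> \<and> (equations_I br \<omega> \<or> equations_II br \<omega>)"
proof -
  obtain g where g: "LCSKT br J g" using ad by (auto simp: admits_LCSKT_def)
  then interpret hermitian_nilpotent_lie_algebra br J g by (intro hermitian_locale) (simp add: LCSKT_def)
  obtain \<alpha> where \<alpha>: "closing_form \<alpha>" "\<alpha> \<noteq> (\<lambda>_. 0)" using g by (auto simp: LCSKT_iff)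
  obtain U V where "br U V \<noteq> 0" using nb by (force simp: bi_invariant_def)
  moreover obtain X where "X \<noteq> 0" "central X" "central (J X)" using nil by (rule central_line_if_nilpotent)
  ultimately show ?thesis using equations_I_or_II_if_closing_form[OF \<alpha>] by blast
qed

lemma hermitian_metric_exists:
  obtains g where "hermitian_metric J g"
proof -
  obtain w1 w2 w3 e1 e2 e3 where f: "dual_frame w1 w2 w3 e1 e2 e3" by (rule some_dual_frame_exists)
  note s = dual_frame_simps[OF f]
  note ss = form_10_simps[OF s(1)] form_10_simps[OF s(2)] form_10_simps[OF s(3)]
  define g where "g X Y = Re (w1 X * cnj (w1 Y) + w2 X * cnj (w2 Y) + w3 X * cnj (w3 Y))" for X Y
  have "bilinear g"
    unfolding bilinear_def by (auto intro!: linearI simp: g_def ss algebra_simps)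
  moreover have "g X X > 0" if "X \<noteq> 0" for X
  proof -
    have "w1 X \<noteq> 0 \<or> w2 X \<noteq> 0 \<or> w3 X \<noteq> 0" using dual_frame_eqI[OF f, of X 0] that by (auto simp: ss)
    moreover have "g X X = (cmod (w1 X))\<^sup>2 + (cmod (w2 X))\<^sup>2 + (cmod (w3 X))\<^sup>2"
      unfolding g_def complex_norm_square[symmetric] cmod_power2 by (simp add: power2_eq_square)
    ultimately show ?thesis by (auto simp: add_pos_nonneg add_nonneg_pos)
  qed
  moreover have "g X Y = g Y X" "g (J X) (J Y) = g X Y" for X Y by (simp_all add: g_def ss algebra_simps)
  ultimately show ?thesis using that[of g] by (simp add: hermitian_metric_def)
qed

lemma LCSKT_I:
  assumes b: "basis_10 J 3 \<omega>" and I: "equations_I br \<omega>" and g: "hermitian_metric J g"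
  shows "LCSKT br J g" "trivial_LCSKT br J g"
    "LCSKT_form br J g \<alpha> \<longleftrightarrow> (\<exists>l. l \<noteq> 0 \<and> (\<forall>X. \<alpha> X = 2 * Re (l * \<omega> 1 X)))"
proof -
  interpret hermitian_nilpotent_lie_algebra br J g using g by (rule hermitian_locale)
  obtain e1 e2 e3 where f: "dual_frame (\<omega> 1) (\<omega> 2) (\<omega> 3) e1 e2 e3" using b by (rule basis_10_dual_frame)
  note iff = closing_form_I_iff[OF f I]
  note s = dual_frame_simps[OF f]
  show *: "LCSKT_form br J g \<alpha> \<longleftrightarrow> (\<exists>l. l \<noteq> 0 \<and> (\<forall>X. \<alpha> X = 2 * Re (l * \<omega> 1 X)))" for \<alpha>
  proof
    assume "LCSKT_form br J g \<alpha>"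
    then obtain l where l: "\<forall>X. \<alpha> X = 2 * Re (l * \<omega> 1 X)" "\<alpha> \<noteq> (\<lambda>_. 0)" by (auto simp: LCSKT_form_iff iff)
    then have "l \<noteq> 0" by auto
    with l show "\<exists>l. l \<noteq> 0 \<and> (\<forall>X. \<alpha> X = 2 * Re (l * \<omega> 1 X))" by blast
  next
    assume "\<exists>l. l \<noteq> 0 \<and> (\<forall>X. \<alpha> X = 2 * Re (l * \<omega> 1 X))"
    then obtain l where l: "l \<noteq> 0" "\<And>X. \<alpha> X = 2 * Re (l * \<omega> 1 X)" by blast
    have "\<alpha> (cmul (inverse l) e1) = 2"
      using l(1) by (simp add: l(2) form_10_simps[OF s(1)] s)
    then have "\<alpha> \<noteq> (\<lambda>_. 0)" by auto
    then show "LCSKT_form br J g \<alpha>" using l(2) by (auto simp: LCSKT_form_iff iff)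
  qed
  have "LCSKT_form br J g (\<lambda>X. 2 * Re (1 * \<omega> 1 X))" unfolding * by (rule exI[of _ 1]) simp
  then show L: "LCSKT br J g" using g by (auto simp: LCSKT_def)
  have "closing_form (\<lambda>_. 0)" unfolding iff by (rule exI[of _ 0]) simp
  then have "SKT br J g" by (simp add: SKT_iff)
  then show "trivial_LCSKT br J g" using L by (simp add: trivial_LCSKT_def SKT_def)
qed

lemma LCSKT_II:
  assumes b: "basis_10 J 3 \<omega>" and II: "equations_II br \<omega>" and g: "hermitian_metric J g"
  shows "LCSKT br J g" "nontrivial_LCSKT br J g"
    "form_parameters \<omega> (fundamental_form J g) r s t u v z \<Longrightarrow> LCSKT_form br J g \<alpha> \<longleftrightarrow>
     (\<forall>X. complex_of_real (\<alpha> X) =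
                    - (2 * \<i> * t * cnj v / (t * s - (cmod v)\<^sup>2) * \<omega> 1 X
                       - 2 * \<i> * t * v / (t * s - (cmod v)\<^sup>2) * cnj (\<omega> 1 X)
                       - 4 * t\<^sup>2 / (t * s - (cmod v)\<^sup>2) * Re (\<omega> 2 X)))"
proof -
  interpret hermitian_nilpotent_lie_algebra br J g using g by (rule hermitian_locale)
  obtain e1 e2 e3 where f: "dual_frame (\<omega> 1) (\<omega> 2) (\<omega> 3) e1 e2 e3" using b by (rule basis_10_dual_frame)
  then have t: "type_II_frame e1 e2 e3" using II equations_II_iff_type_II_frame by blast
  have not_skt: "\<not> closing_form (\<lambda>_. 0)" using dH_II_nonzero[OF f t] by (simp add: SKT_iff[symmetric] SKT_def)
  have *: "LCSKT_form br J g \<alpha> \<longleftrightarrow> closing_form \<alpha>" for \<alpha> using not_skt by (auto simp: LCSKT_form_iff)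
  have "\<exists>\<alpha>. closing_form \<alpha>" unfolding closing_form_II_iff[OF f t] by (rule exI, rule allI, rule refl)
  then show L: "LCSKT br J g" unfolding LCSKT_def * using g by blast
  show "nontrivial_LCSKT br J g" using L dH_II_nonzero[OF f t] by (simp add: nontrivial_LCSKT_def)
  show "LCSKT_form br J g \<alpha> \<longleftrightarrow>
     (\<forall>X. complex_of_real (\<alpha> X) =
                    - (2 * \<i> * t * cnj v / (t * s - (cmod v)\<^sup>2) * \<omega> 1 X
                       - 2 * \<i> * t * v / (t * s - (cmod v)\<^sup>2) * cnj (\<omega> 1 X)
                       - 4 * t\<^sup>2 / (t * s - (cmod v)\<^sup>2) * Re (\<omega> 2 X)))"
    if "form_parameters \<omega> (fundamental_form J g) r s t u v z"
    unfolding * by (rule closing_form_II_parameters[OF f t that])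
qed

text \<open>A second complex structure on the same Lie algebra has its own frames, so equations (II) are of use
  only through a property of the bracket: \<open>[e1, [e1, Je1]] = - 4 Je3\<close>, against lemma \<open>SKT_two_step\<close>.\<close>

lemma not_admits_SKT_II:
  assumes b: "basis_10 J 3 \<omega>" and II: "equations_II br \<omega>"
  shows "\<not> admits_SKT br"
proof
  assume "admits_SKT br"
  then obtain J' g where J': "complex_structure br J'" and skt: "SKT br J' g" by (auto simp: admits_SKT_def)
  interpret J': nilpotent_complex_lie_algebra br J' using lie dim nilpotent J' by unfold_locales
  interpret J': hermitian_nilpotent_lie_algebra br J' g
    using skt by (intro J'.hermitian_locale) (simp add: SKT_def)
  obtain e1 e2 e3 where f: "dual_frame (\<omega> 1) (\<omega> 2) (\<omega> 3) e1 e2 e3" using b by (rule basis_10_dual_frame)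
  then have t: "type_II_frame e1 e2 e3" using II equations_II_iff_type_II_frame by blast
  have "br e1 (br e1 (J e1)) = 0" using J'.SKT_two_step skt by (simp add: J'.SKT_iff)
  then have "J e3 = 0" using t by (simp add: type_II_frame_def)
  then have "\<omega> 3 (J e3) = 0" using form_10_simps(4)[OF dual_frame_simps(3)[OF f]] by simp
  then show False using form_10_simps(6)[OF dual_frame_simps(3)[OF f]] dual_frame_simps(12)[OF f] by simp
qed

end

theorem theorem3p1:
  fixes br :: "'a::real_vector \<Rightarrow> 'a \<Rightarrow> 'a" and J :: "'a \<Rightarrow> 'a"
  assumes "lie_algebra br" and "dim (UNIV :: 'a set) = 6" and "nilpotent_lie_algebra br"
    and "complex_structure br J" and "\<not> bi_invariant br J"
  shows
    "(\<not> nilpotent_complex_structure br J \<longrightarrow> \<not> admits_LCSKT br J) \<and>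
     (nilpotent_complex_structure br J \<longrightarrow>
        (admits_LCSKT br J \<longleftrightarrow> (\<exists>\<omega>. basis_10 J 3 \<omega> \<and> (equations_I br \<omega> \<or> equations_II br \<omega>)))) \<and>
     (\<forall>\<omega>. basis_10 J 3 \<omega> \<and> (equations_I br \<omega> \<or> equations_II br \<omega>) \<longrightarrow>
        (\<forall>g. hermitian_metric J g \<longrightarrow> LCSKT br J g)) \<and>
     (\<forall>\<omega>. basis_10 J 3 \<omega> \<and> equations_I br \<omega> \<longrightarrow>
        (\<forall>g. LCSKT br J g \<longrightarrow>
           trivial_LCSKT br J g \<and>
           (\<forall>\<alpha>. LCSKT_form br J g \<alpha> \<longleftrightarrow>
              (\<exists>l1::complex. l1 \<noteq> 0 \<and> (\<forall>X. \<alpha> X = 2 * Re (l1 * \<omega> 1 X)))))) \<and>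
     (\<forall>\<omega>. basis_10 J 3 \<omega> \<and> equations_II br \<omega> \<longrightarrow>
        (\<forall>g. LCSKT br J g \<longrightarrow>
           nontrivial_LCSKT br J g \<and>
           (\<forall>r s t u v z. form_parameters \<omega> (fundamental_form J g) r s t u v z \<longrightarrow>
              (\<forall>\<alpha>. LCSKT_form br J g \<alpha> \<longleftrightarrow>
                 (\<forall>X. complex_of_real (\<alpha> X) =
                    - (2 * \<i> * t * cnj v / (t * s - (cmod v)\<^sup>2) * \<omega> 1 X
                       - 2 * \<i> * t * v / (t * s - (cmod v)\<^sup>2) * cnj (\<omega> 1 X)
                       - 4 * t\<^sup>2 / (t * s - (cmod v)\<^sup>2) * Re (\<omega> 2 X)))))) \<and>
        \<not> admits_SKT br)"
proof -
  interpret nilpotent_complex_lie_algebra br J using assms(1-4) by unfold_locales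
  have hermitian: "hermitian_metric J g" if "LCSKT br J g" for g using that by (simp add: LCSKT_def)
  have "admits_LCSKT br J" if "basis_10 J 3 \<omega>" "equations_I br \<omega> \<or> equations_II br \<omega>" for \<omega>
    using hermitian_metric_exists LCSKT_I(1) LCSKT_II(1) that unfolding admits_LCSKT_def by metis
  then have existence: "admits_LCSKT br J \<longleftrightarrow> (\<exists>\<omega>. basis_10 J 3 \<omega> \<and> (equations_I br \<omega> \<or> equations_II br \<omega>))"
    if "nilpotent_complex_structure br J"
    using equations_if_admits_LCSKT that assms(5) by blast
  show ?thesis
  proof (intro conjI)
    show "\<not> nilpotent_complex_structure br J \<longrightarrow> \<not> admits_LCSKT br J"
      using not_LCSKT_if_not_nilpotent by blast
  next
    show "nilpotent_complex_structure br J \<longrightarrow>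
        (admits_LCSKT br J \<longleftrightarrow> (\<exists>\<omega>. basis_10 J 3 \<omega> \<and> (equations_I br \<omega> \<or> equations_II br \<omega>)))"
      using existence by blast
  next
    show "\<forall>\<omega>. basis_10 J 3 \<omega> \<and> (equations_I br \<omega> \<or> equations_II br \<omega>) \<longrightarrow>
        (\<forall>g. hermitian_metric J g \<longrightarrow> LCSKT br J g)"
      using LCSKT_I(1) LCSKT_II(1) by blast
  qed (intro allI impI conjI; elim conjE;
      rule LCSKT_I(2,3)[OF _ _ hermitian] LCSKT_II(2,3)[OF _ _ hermitian] not_admits_SKT_II; assumption)+
qed

end
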